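(* Let $|\Psi\rangle_{AB}$ be a bipartite pure state and let an arbitrary SLOCC protocol transform it into the ensemble $\{p_m,|\Psi_m\rangle_{AB}\}$. Write $\Delta E_\alpha(\Psi_m)=E_\alpha(\Psi_m)-E_\alpha(\Psi)$ and $$\langle e^{s(1-\alpha)\Delta E_\alpha}\rangle=\sum_m p_m\, e^{s(1-\alpha)\Delta E_\alpha(\Psi_m)} .$$ Then: (a) if $0<\alpha<1$ and $s\le \frac1\alpha$, then $\langle e^{s(1-\alpha)\Delta E_\alpha}\rangle\le 1$; (b) if $\alpha>1$ and $s\ge\frac1\alpha$, then $\langle e^{s(1-\alpha)\Delta E_\alpha}\rangle\ge 1$.
   Context: All Hilbert spaces are finite-dimensional; $\log$ is the natural logarithm. For a unit vector $|\Psi\rangle_{AB}\in\mathcal H_A\otimes\mathcal H_B$ put $\rho_B=\mathrm{Tr}_A|\Psi\rangle\langle\Psi|$. For $\alpha>0$, $\alpha\ne1$, the Rényi entanglement entropy (REE) is $E_\alpha(\Psi)=\frac{1}{1-\alpha}\log\mathrm{Tr}[\rho_B^\alpha]$. SLOCC (stochastic local operations and classical communication) protocol on pure states: a finite number of rounds; in each round one of the two parties (chosen depending on previous outcomes) applies a local measurement, i.e. a finite family of Kraus operators $\{K_j\}$ on its own system (possibly with a different finite-dimensional output space) with $\sum_jK_j^\dagger K_j=\mathbb 1$, which may depend on all previously obtained (classically communicated) outcomes. A sequence $m$ of outcomes corresponds to a product operator $A_m\otimes B_m$; it occurs with probability $p_m=\|(A_m\otimes B_m)|\Psi\rangle\|^2$,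 and (if $p_m>0$) the outcome state is $|\Psi_m\rangle=(A_m\otimes B_m)|\Psi\rangle/\sqrt{p_m}$. Thus $\sum_mp_m=1$, and one writes $|\Psi\rangle\to\{p_m,|\Psi_m\rangle\}$ (outcomes with $p_m=0$ are discarded).
   Formalization: Part (a) is stated and proved for 0 ≤ s ≤ 1/α only; for s < 0 the printed claim is false: with α = 1/2, s = −1, a Bell state and Alice measuring in the computational basis, the average equals √2 > 1. *)

theory Defs
  imports "Jordan_Normal_Form.Schur_Decomposition"
begin

text \<open>The Hilbert space of dimension \<open>d\<close> is \<open>\<complex>\<^sup>d\<close>, i.e. \<^term>\<open>carrier_vec d :: complex vec set\<close>.
  The product space \<open>\<complex>\<^sup>a \<otimes> \<complex>\<^sup>b\<close> has dimension \<open>a * b\<close>, where \<open>e\<^sub>i \<otimes> e\<^sub>j\<close> is the unit vector with index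
  \<open>i * b + j\<close>.\<close>

definition kron :: "complex mat \<Rightarrow> complex mat \<Rightarrow> complex mat" where
  "kron A B = mat (dim_row A * dim_row B) (dim_col A * dim_col B)
     (\<lambda>(i, j). A $$ (i div dim_row B, j div dim_col B) * B $$ (i mod dim_row B, j mod dim_col B))"

definition vec_norm :: "complex vec \<Rightarrow> real" where
  "vec_norm v = sqrt (Re (v \<bullet>c v))"

definition ketbra :: "complex vec \<Rightarrow> complex mat" where
  "ketbra v = mat (dim_vec v) (dim_vec v) (\<lambda>(i, j). v $ i * cnj (v $ j))"

definition ptrace_A :: "nat \<Rightarrow> nat \<Rightarrow> complex mat \<Rightarrow> complex mat" where
  "ptrace_A a b R = mat b b (\<lambda>(j, k). \<Sum>i<a. R $$ (i * b + j, i * b + k))"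

definition mat_trace :: "complex mat \<Rightarrow> complex" where
  "mat_trace A = (\<Sum>i<dim_row A. A $$ (i, i))"

definition unitary_diag :: "complex mat \<Rightarrow> complex mat \<Rightarrow> (nat \<Rightarrow> real) \<Rightarrow> bool" where
  "unitary_diag A U d \<longleftrightarrow>
     (let n = dim_row A in
        U \<in> carrier_mat n n \<and> mat_adjoint U * U = 1\<^sub>m n \<and> U * mat_adjoint U = 1\<^sub>m n \<and>
        A = U * mat_diag n (\<lambda>i. complex_of_real (d i)) * mat_adjoint U)"

text \<open>Real powers of a positive semidefinite matrix by functional calculus,
  \<open>A\<^sup>\<alpha> = U diag(d\<^sub>i\<^sup>\<alpha>) U\<^sup>\<dagger>\<close> for any unitary diagonalization \<open>A = U diag(d\<^sub>i) U\<^sup>\<dagger>\<close>;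
  \<open>mat_powr_eq\<close> shows that the choice of diagonalization is immaterial.
  Because \<open>0 powr \<alpha> = 0\<close>, the kernel of \<open>A\<close> does not contribute.\<close>

definition mat_powr :: "complex mat \<Rightarrow> real \<Rightarrow> complex mat" where
  "mat_powr A \<alpha> = (THE B. \<exists>U d. unitary_diag A U d \<and>
     B = U * mat_diag (dim_row A) (\<lambda>i. complex_of_real (d i powr \<alpha>)) * mat_adjoint U)"

lemma unitary_diag_fun_unique:
  fixes f :: "real \<Rightarrow> real"
  assumes "unitary_diag A U d" and "unitary_diag A V e" and n: "n = dim_row A"
  shows "U * mat_diag n (\<lambda>i. complex_of_real (f (d i))) * mat_adjoint U
       = V * mat_diag n (\<lambda>i. complex_of_real (f (e i))) * mat_adjoint V"
proof -
  define D E where "D g = mat_diag n (\<lambda>i. complex_of_real (g (d i)))"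
    and "E g = mat_diag n (\<lambda>i. complex_of_real (g (e i)))" for g :: "real \<Rightarrow> real"
  define U' V' where "U' = mat_adjoint U" and "V' = mat_adjoint V"
  have U: "U \<in> carrier_mat n n" "U' * U = 1\<^sub>m n" "U * U' = 1\<^sub>m n" "A = U * D id * U'"
    and V: "V \<in> carrier_mat n n" "V' * V = 1\<^sub>m n" "V * V' = 1\<^sub>m n" "A = V * E id * V'"
    using assms unfolding unitary_diag_def Let_def D_def E_def U'_def V'_def by auto
  have c [simp]: "U' \<in> carrier_mat n n" "V' \<in> carrier_mat n n" "U \<in> carrier_mat n n"
      "V \<in> carrier_mat n n" "D g \<in> carrier_mat n n" "E g \<in> carrier_mat n n" for g
    using U(1) V(1) unfolding U'_def V'_def mat_adjoint_def D_def E_def by auto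
  define W where "W = V' * U"
  have a: "X * Y * Z = X * (Y * Z)"
    if "X \<in> carrier_mat n n" "Y \<in> carrier_mat n n" "Z \<in> carrier_mat n n" for X Y Z :: "complex mat"
    using that by (rule assoc_mult_mat)
  have cc [simp]: "X * Y \<in> carrier_mat n n"
    if "X \<in> carrier_mat n n" "Y \<in> carrier_mat n n" for X Y :: "complex mat"
    using that by (rule mult_carrier_mat)
  have W [simp]: "W \<in> carrier_mat n n" unfolding W_def by simp
  have "V' * (U * D id * U') * U = V' * (V * E id * V') * U" using U(4) V(4) by simp
  moreover have "V' * (U * D id * U') * U = W * D id * (U' * U)"
    unfolding W_def by (simp add: a)
  moreover have "V' * (V * E id * V') * U = (V' * V) * (E id * W)"
    unfolding W_def by (simp add: a)
  ultimately have comm: "W * D id = E id * W" using U(2) V(2)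
    by (metis W c(5,6) cc left_mult_one_mat right_mult_one_mat)
  have "W * D f = E f * W"
  proof (rule eq_matI)
    fix i j assume "i < dim_row (E f * W)" "j < dim_col (E f * W)"
    then have ij: "i < n" "j < n" using carrier_matD[OF cc[OF c(6) W]] by auto
    have x: "(W * D g) $$ (i, j) = W $$ (i, j) * complex_of_real (g (d j))"
         "(E g * W) $$ (i, j) = complex_of_real (g (e i)) * W $$ (i, j)" for g
      unfolding D_def E_def using ij mat_diag_mult_right[OF W] mat_diag_mult_left[OF W] by auto
    have "W $$ (i, j) = 0 \<or> d j = e i" using x[of id] comm by auto
    then show "(W * D f) $$ (i, j) = (E f * W) $$ (i, j)" unfolding x by auto
  qed (use carrier_matD[OF cc[OF c(6) W]] carrier_matD[OF cc[OF W c(5)]] in auto)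
  then have "V * (W * D f) * U' = V * (E f * W) * U'" by simp
  moreover have "V * (W * D f) * U' = (V * V') * (U * D f * U')"
    unfolding W_def by (simp add: a)
  moreover have "V * (E f * W) * U' = (V * E f * V') * (U * U')"
    unfolding W_def by (simp add: a)
  ultimately show ?thesis using U(3) V(3) unfolding D_def[symmetric] E_def[symmetric]
    U'_def[symmetric] V'_def[symmetric]
    by (metis c cc left_mult_one_mat right_mult_one_mat)
qed

lemma mat_powr_eq:
  assumes "unitary_diag A U d"
  shows "mat_powr A \<alpha> =
    U * mat_diag (dim_row A) (\<lambda>i. complex_of_real (d i powr \<alpha>)) * mat_adjoint U"
  unfolding mat_powr_def
  by (rule the_equality) (use assms unitary_diag_fun_unique[OF _ assms refl] in auto)

definition reduced_B :: "nat \<Rightarrow> nat \<Rightarrow> complex vec \<Rightarrow> complex mat" where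
  "reduced_B a b \<Psi> = ptrace_A a b (ketbra \<Psi>)"

definition renyi_ee :: "real \<Rightarrow> nat \<Rightarrow> nat \<Rightarrow> complex vec \<Rightarrow> real" where
  "renyi_ee \<alpha> a b \<Psi> = 1 / (1 - \<alpha>) * ln (Re (mat_trace (mat_powr (reduced_B a b \<Psi>) \<alpha>)))"

text \<open>The output space of a Kraus operator \<open>K\<close> has dimension \<^term>\<open>dim_row K\<close>, which may vary
  with the outcome.\<close>

definition kraus_family :: "nat \<Rightarrow> complex mat list \<Rightarrow> bool" where
  "kraus_family d Ks \<longleftrightarrow> (\<forall>K \<in> set Ks. dim_col K = d) \<and>
     foldr (+) (map (\<lambda>K. mat_adjoint K * K) Ks) (0\<^sub>m d d) = 1\<^sub>m d"

text \<open>A protocol is a finite tree: each inner node is a local measurement of one party, given by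
  the list of its Kraus operators, each paired with the continuation after that outcome.
  So both the acting party and its measurement may depend on all earlier outcomes.\<close>

datatype slocc =
    Stop
  | Measure_A "(complex mat \<times> slocc) list"
  | Measure_B "(complex mat \<times> slocc) list"

fun valid_slocc :: "nat \<Rightarrow> nat \<Rightarrow> slocc \<Rightarrow> bool" where
  "valid_slocc a b Stop \<longleftrightarrow> True"
| "valid_slocc a b (Measure_A ms) \<longleftrightarrow> kraus_family a (map fst ms) \<and>
     (\<forall>(K, P) \<in> set ms. valid_slocc (dim_row K) b P)"
| "valid_slocc a b (Measure_B ms) \<longleftrightarrow> kraus_family b (map fst ms) \<and>
     (\<forall>(K, P) \<in> set ms. valid_slocc a (dim_row K) P)"

text \<open>The pairs \<open>(A\<^sub>m, B\<^sub>m)\<close> of accumulated local operators, one for each sequence \<open>m\<close> of outcomes,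
  i.e. for each leaf of the tree; later Kraus operators multiply from the left.\<close>

fun outcome_ops :: "nat \<Rightarrow> nat \<Rightarrow> slocc \<Rightarrow> (complex mat \<times> complex mat) list" where
  "outcome_ops a b Stop = [(1\<^sub>m a, 1\<^sub>m b)]"
| "outcome_ops a b (Measure_A ms) =
     concat (map (\<lambda>(K, P). map (\<lambda>(A, B). (A * K, B)) (outcome_ops (dim_row K) b P)) ms)"
| "outcome_ops a b (Measure_B ms) =
     concat (map (\<lambda>(K, P). map (\<lambda>(A, B). (A, B * K)) (outcome_ops a (dim_row K) P)) ms)"

definition outcome_prob :: "complex vec \<Rightarrow> complex mat \<times> complex mat \<Rightarrow> real" where
  "outcome_prob \<Psi> m = (vec_norm (kron (fst m) (snd m) *\<^sub>v \<Psi>))\<^sup>2"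

definition outcome_state :: "complex vec \<Rightarrow> complex mat \<times> complex mat \<Rightarrow> complex vec" where
  "outcome_state \<Psi> m =
     complex_of_real (1 / sqrt (outcome_prob \<Psi> m)) \<cdot>\<^sub>v (kron (fst m) (snd m) *\<^sub>v \<Psi>)"

text \<open>The ensemble \<open>{p\<^sub>m, |\<Psi>\<^sub>m\<rangle>}\<close> as a list of tuples \<open>(p\<^sub>m, a\<^sub>m, b\<^sub>m, \<Psi>\<^sub>m)\<close> with
  \<open>\<Psi>\<^sub>m \<in> \<complex>\<^sup>a \<otimes> \<complex>\<^sup>b\<close> for \<open>a = a\<^sub>m\<close>, \<open>b = b\<^sub>m\<close>; a list, since different outcomes may yield the same state.\<close>

definition ensemble :: "nat \<Rightarrow> nat \<Rightarrow> slocc \<Rightarrow> complex vec \<Rightarrow> (real \<times> nat \<times> nat \<times> complex vec) list" where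
  "ensemble a b P \<Psi> =
     map (\<lambda>m. (outcome_prob \<Psi> m, dim_row (fst m), dim_row (snd m), outcome_state \<Psi> m))
       (filter (\<lambda>m. outcome_prob \<Psi> m > 0) (outcome_ops a b P))"

definition ree_exp_average :: "real \<Rightarrow> real \<Rightarrow> nat \<Rightarrow> nat \<Rightarrow> slocc \<Rightarrow> complex vec \<Rightarrow> real" where
  "ree_exp_average \<alpha> s a b P \<Psi> =
     (\<Sum>(p, a', b', \<Phi>) \<leftarrow> ensemble a b P \<Psi>.
        p * exp (s * (1 - \<alpha>) * (renyi_ee \<alpha> a' b' \<Phi> - renyi_ee \<alpha> a b \<Psi>)))"

end

theory Submission
  imports Defs "HOL-Analysis.Convex" "HOL-Computational_Algebra.Fundamental_Theorem_Algebra"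
begin

text \<open>Arrange the amplitudes of \<open>\<Psi>\<close> in a \<open>b \<times> a\<close> matrix \<open>N\<close>. Then \<open>\<rho>\<^sub>B = N N\<^sup>\<dagger>\<close>, and \<open>(A \<otimes> B) \<Psi>\<close>
  corresponds to \<open>B N A\<^sup>T\<close>. A measurement by party A writes \<open>N N\<^sup>\<dagger>\<close>, and one by B writes \<open>N\<^sup>\<dagger> N\<close>, as
  the sum of the corresponding unnormalised matrices of the outcomes; both have the same nonzero
  spectrum. So the Minkowski inequality for \<open>\<parallel>X\<parallel>\<^sub>\<alpha> = (Tr X\<^sup>\<alpha>)\<^bsup>1/\<alpha>\<^esup>\<close> on positive matrices, which is
  reversed for \<open>\<alpha> < 1\<close>, makes \<open>\<Sum>\<^sub>m p\<^sub>m (Tr \<rho>\<^sub>m\<^sup>\<alpha>)\<^bsup>1/\<alpha>\<^esup>\<close> monotone along the protocol tree. This is the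
  case \<open>s = 1/\<alpha>\<close>, and Jensen's inequality for \<open>t \<mapsto> t\<^bsup>s\<alpha>\<^esup>\<close> gives the other \<open>s\<close>. The matrix Minkowski
  inequality reduces to the scalar one by comparing \<open>Tr X\<^sup>\<alpha>\<close> with the power sum of the diagonal of \<open>X\<close>
  in an eigenbasis of the total matrix (Peierls).\<close>

unbundle no inner_syntax

subsection \<open>Unitary diagonalization of Hermitian matrices\<close>

lemma mat_adjoint_dim [simp]:
  "dim_row (mat_adjoint A) = dim_col A" "dim_col (mat_adjoint A) = dim_row A"
  by (auto simp: mat_adjoint_def)

lemma mat_adjoint_carrier [simp]:
  "A \<in> carrier_mat n m \<Longrightarrow> mat_adjoint A \<in> carrier_mat m n"
  by (auto intro: carrier_matI)

lemma mat_adjoint_index [simp]: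
  fixes A :: "complex mat"
  shows "i < dim_col A \<Longrightarrow> j < dim_row A \<Longrightarrow> mat_adjoint A $$ (i, j) = cnj (A $$ (j, i))"
  by (simp add: mat_adjoint_def mat_of_rows_def)

lemma mat_adjoint_adjoint [simp]: "mat_adjoint (mat_adjoint A) = (A :: complex mat)"
  by (rule eq_matI) auto

text \<open>Gives entries of products as plain sums. It is used with
  \<open>index_mult_mat(1)\<close> deleted, so that the simplifier does not turn the entries into
  scalar products of rows and columns instead.\<close>

lemma mult_index_sum:
  fixes A B :: "'a :: semiring_0 mat"
  assumes "i < dim_row A" "j < dim_col B" "dim_col A = dim_row B"
  shows "(A * B) $$ (i, j) = (\<Sum>k<dim_row B. A $$ (i, k) * B $$ (k, j))"
  using assms by (simp add: scalar_prod_def atLeast0LessThan)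

lemma mat_adjoint_mult:
  fixes A B :: "complex mat"
  assumes "A \<in> carrier_mat n m" "B \<in> carrier_mat m k"
  shows "mat_adjoint (A * B) = mat_adjoint B * mat_adjoint A"
proof (rule eq_matI)
  fix i j assume "i < dim_row (mat_adjoint B * mat_adjoint A)" "j < dim_col (mat_adjoint B * mat_adjoint A)"
  then show "mat_adjoint (A * B) $$ (i, j) = (mat_adjoint B * mat_adjoint A) $$ (i, j)"
    using assms by (simp del: index_mult_mat(1) add: mult_index_sum mult.commute)
qed (use assms in auto)

lemma mult_carrier_square:
  "A \<in> carrier_mat n n \<Longrightarrow> B \<in> carrier_mat n n \<Longrightarrow> A * B \<in> carrier_mat n n"
  by (rule mult_carrier_mat)

text \<open>For square matrices a left inverse is also a right inverse, so
  \<open>unitary_mat_adjoint\<close> gives the other identity.\<close>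

definition unitary_mat :: "nat \<Rightarrow> complex mat \<Rightarrow> bool" where
  "unitary_mat n U \<longleftrightarrow> U \<in> carrier_mat n n \<and> mat_adjoint U * U = 1\<^sub>m n"

lemma unitary_mat_adjoint:
  assumes "unitary_mat n U" shows "unitary_mat n (mat_adjoint U)" and "U * mat_adjoint U = 1\<^sub>m n"
  using assms mat_mult_left_right_inverse[of "mat_adjoint U" n U] by (auto simp: unitary_mat_def)

lemma unitary_mat_mult:
  assumes "unitary_mat n U" "unitary_mat n V" shows "unitary_mat n (U * V)"
proof -
  have c: "U \<in> carrier_mat n n" "V \<in> carrier_mat n n" and e: "mat_adjoint U * U = 1\<^sub>m n" "mat_adjoint V * V = 1\<^sub>m n"
    using assms by (auto simp: unitary_mat_def)
  have "mat_adjoint (U * V) * (U * V) = mat_adjoint V * ((mat_adjoint U * U) * V)"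
    using c by (simp add: mat_adjoint_mult[OF c] assoc_mult_mat[of _ n n _ n _ n])
  then show ?thesis using c e by (simp add: unitary_mat_def)
qed

lemma unitary_diagI:
  assumes "unitary_mat n U" "A \<in> carrier_mat n n"
    "mat_adjoint U * A * U = mat_diag n (\<lambda>i. complex_of_real (d i))"
  shows "unitary_diag A U d"
proof -
  have c: "U \<in> carrier_mat n n" and i: "mat_adjoint U * U = 1\<^sub>m n" "U * mat_adjoint U = 1\<^sub>m n"
    using assms(1) unitary_mat_adjoint(2) by (auto simp: unitary_mat_def)
  have "U * (mat_adjoint U * A * U) * mat_adjoint U = (U * mat_adjoint U) * A * (U * mat_adjoint U)"
    using c assms(2) by (simp add: assoc_mult_mat[of _ n n _ n _ n] mult_carrier_square)
  then have "A = U * (mat_adjoint U * A * U) * mat_adjoint U" using i assms(2) by simp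
  then show ?thesis using c i assms(2,3) by (simp add: unitary_diag_def)
qed

lemma unitary_diagD:
  assumes "unitary_diag A U d" "A \<in> carrier_mat n n"
  shows "unitary_mat n U" "A = U * mat_diag n (\<lambda>i. complex_of_real (d i)) * mat_adjoint U"
    "mat_adjoint U * A * U = mat_diag n (\<lambda>i. complex_of_real (d i))"
proof -
  let ?D = "mat_diag n (\<lambda>i. complex_of_real (d i))"
  show u: "unitary_mat n U" and A: "A = U * ?D * mat_adjoint U"
    using assms by (auto simp: unitary_diag_def unitary_mat_def Let_def)
  have c: "U \<in> carrier_mat n n" "?D \<in> carrier_mat n n" and i: "mat_adjoint U * U = 1\<^sub>m n"
    using u by (auto simp: unitary_mat_def)
  have "mat_adjoint U * (U * ?D * mat_adjoint U) * U = (mat_adjoint U * U) * ?D * (mat_adjoint U * U)"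
    using c by (simp add: assoc_mult_mat[of _ n n _ n _ n] mult_carrier_square)
  then show "mat_adjoint U * A * U = ?D" using i c A by simp
qed

section \<open>The spectral theorem for Hermitian matrices\<close>

text \<open>Extend \<open>v\<close> to a basis and apply Gram-Schmidt, which keeps the first vector.
  The result is orthogonal but not normalised, so every column is rescaled by \<open>r\<close>; this
  produces the scalar \<open>c\<close>.\<close>

lemma unit_vec_completion:
  fixes v :: "complex vec"
  assumes v: "v \<in> carrier_vec n" and v0: "v \<noteq> 0\<^sub>v n" and n: "0 < n"
  obtains Q c where "unitary_mat n Q" "col Q 0 = c \<cdot>\<^sub>v v"
proof -
  interpret cof_vec_space n "TYPE(complex)" .
  define b where "b = basis_completion v"
  define ws where "ws = gram_schmidt n b"
  from basis_completion[OF v v0, folded b_def]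
  have dist_b: "distinct b" and indep: "\<not> lin_dep (set b)" and b: "set b \<subseteq> carrier_vec n" 
    and hdb: "hd b = v" and len_b: "length b = n" by auto
  from hdb len_b n obtain vs where bv: "b = v # vs" by (cases b) auto
  from gram_schmidt_result[OF b dist_b indep refl, folded ws_def]
  have ws: "set ws \<subseteq> carrier_vec n" "corthogonal ws" "length ws = n" 
    by (auto simp: len_b)
  have hdws: "hd ws = v" using gram_schmidt_hd[OF v, of vs, folded bv] unfolding ws_def .
  define r where "r w = complex_of_real (1 / sqrt (Re (w \<bullet>c w)))" for w :: "complex vec"
  define Q where "Q = mat_of_cols n (map (\<lambda>w. r w \<cdot>\<^sub>v w) ws)"
  have wc: "ws ! i \<in> carrier_vec n" if "i < n" for i using ws that by auto
  have Q: "Q \<in> carrier_mat n n" using ws mat_of_cols_carrier(1)[of n "map (\<lambda>w. r w \<cdot>\<^sub>v w) ws"] 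
    by (simp add: Q_def)
  have colQ: "col Q i = r (ws ! i) \<cdot>\<^sub>v (ws ! i)" if "i < n" for i
    using that ws wc[OF that] by (simp add: Q_def)
  have "mat_adjoint Q * Q = 1\<^sub>m n"
  proof (rule eq_matI)
    fix i j assume "i < dim_row (1\<^sub>m n :: complex mat)" "j < dim_col (1\<^sub>m n :: complex mat)"
    then have i: "i < n" and j: "j < n" by auto
    have "(mat_adjoint Q * Q) $$ (i, j) = conjugate (col Q i) \<bullet> col Q j"
      using Q i j by (simp add: mat_adjoint_def)
    also have "\<dots> = cnj (r (ws ! i)) * r (ws ! j) * (ws ! j \<bullet>c ws ! i)"
      using wc[OF i] wc[OF j] comm_scalar_prod[of "ws ! j" n "conjugate (ws ! i)"]
      by (simp add: colQ[OF i] colQ[OF j] conjugate_smult_vec)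
    also have "\<dots> = (if i = j then 1 else 0)"
    proof (cases "i = j")
      case True
      have "ws ! i \<bullet>c ws ! i \<noteq> 0" using corthogonalD[OF ws(2), of i i] i ws(3) by auto
      moreover have "ws ! i \<bullet>c ws ! i \<ge> 0" using conjugate_square_ge_0_vec[of "ws ! i"] by simp
      \<comment> \<open>In the order on the complex numbers, a nonnegative element is real.\<close>
      ultimately obtain x where x: "ws ! i \<bullet>c ws ! i = complex_of_real x" "x > 0"
        by (metis complex_eq_iff complex_is_Real_iff of_real_Re less_eq_complex_def of_real_0 order_less_le zero_complex.simps)
      have "cnj (r (ws ! i)) * r (ws ! i) * complex_of_real x = complex_of_real (1 / sqrt x * (1 / sqrt x) * x)"
        unfolding r_def x(1) by (simp only: complex_cnj_complex_of_real of_real_mult Re_complex_of_real)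
      also have "1 / sqrt x * (1 / sqrt x) * x = 1" using x(2) by simp
      finally show ?thesis using True x by simp
    next
      case False then show ?thesis using corthogonalD[OF ws(2), of j i] i j ws(3) by auto
    qed
    finally show "(mat_adjoint Q * Q) $$ (i, j) = 1\<^sub>m n $$ (i, j)" using i j by simp
  qed (use Q in auto)
  moreover have "ws ! 0 = v" using hdws ws(3) n by (metis hd_conv_nth length_greater_0_conv)
  ultimately show ?thesis using that Q colQ[OF n] by (auto simp: unitary_mat_def)
qed

text \<open>The characteristic polynomial has degree \<open>n > 0\<close>, hence a complex
  root.\<close>

lemma eigenvector_exists:
  fixes A :: "complex mat"
  assumes "A \<in> carrier_mat n n" "0 < n"
  obtains v e where "v \<in> carrier_vec n" "v \<noteq> 0\<^sub>v n" "A *\<^sub>v v = e \<cdot>\<^sub>v v"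
proof -
  have "\<not> constant (poly (char_poly A))"
    using degree_monic_char_poly[OF assms(1)] assms(2) by (auto simp: constant_degree)
  then obtain e where "poly (char_poly A) e = 0" using fundamental_theorem_of_algebra by blast
  then have "eigenvalue A e" using eigenvalue_root_char_poly[OF assms(1)] by simp
  then show ?thesis using that assms(1) unfolding eigenvalue_def eigenvector_def by auto
qed

lemma mult_block_diag:
  fixes A B C D :: "complex mat"
  assumes "A \<in> carrier_mat k k" "C \<in> carrier_mat k k" "B \<in> carrier_mat m m" "D \<in> carrier_mat m m"
  shows "four_block_mat A (0\<^sub>m k m) (0\<^sub>m m k) B * four_block_mat C (0\<^sub>m k m) (0\<^sub>m m k) D
    = four_block_mat (A * C) (0\<^sub>m k m) (0\<^sub>m m k) (B * D)"
proof -
  have "A * C \<in> carrier_mat k k" "B * D \<in> carrier_mat m m" using assms by auto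
  then show ?thesis using assms by (subst mult_four_block_mat[of _ k k _ m _ m]) auto
qed

text \<open>Deflation, by induction on \<open>n\<close>: an eigenvector becomes the first column of
  a unitary \<open>Q\<close>, and conjugation by \<open>Q\<close> splits \<open>A\<close> into a
  real 1 x 1 block and a smaller Hermitian block \<open>A3\<close>, which the induction hypothesis
  diagonalises.\<close>

theorem hermitian_unitary_diag:
  assumes "A \<in> carrier_mat n n" "mat_adjoint A = A"
  obtains U d where "unitary_diag A U d"
proof -
  have "\<exists>U d. unitary_diag A U d"
    using assms
  proof (induction n arbitrary: A)
    case 0
    then have "unitary_diag A (1\<^sub>m 0) (\<lambda>_. 0)"
      by (intro unitary_diagI[of 0]) (auto simp: unitary_mat_def mat_diag_def intro!: eq_matI)
    then show ?case by blast
  next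
    case (Suc m)
    let ?n = "Suc m"
    note A = Suc.prems(1)
    obtain v e where v: "v \<in> carrier_vec ?n" "v \<noteq> 0\<^sub>v ?n" "A *\<^sub>v v = e \<cdot>\<^sub>v v"
      using eigenvector_exists[OF A] by auto
    obtain Q c where Q: "unitary_mat ?n Q" "col Q 0 = c \<cdot>\<^sub>v v"
      using unit_vec_completion[OF v(1,2)] by auto
    have Qc: "Q \<in> carrier_mat ?n ?n" and QQ: "mat_adjoint Q * Q = 1\<^sub>m ?n"
      using Q(1) by (auto simp: unitary_mat_def)
    define B where "B = mat_adjoint Q * A * Q"
    have Bc: "B \<in> carrier_mat ?n ?n" using A Qc by (auto simp: B_def)
    have BB: "mat_adjoint B = B"
      using A Qc Suc.prems(2) unfolding B_def
      by (simp add: mat_adjoint_mult[of _ ?n ?n _ ?n] assoc_mult_mat[of _ ?n ?n _ ?n _ ?n] mult_carrier_square)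
    have "col B 0 = mat_adjoint Q *\<^sub>v (A *\<^sub>v col Q 0)"
      unfolding B_def assoc_mult_mat[OF mat_adjoint_carrier[OF Qc] A Qc]
        col_mult2[OF mat_adjoint_carrier[OF Qc] mult_carrier_mat[OF A Qc] zero_less_Suc]
        col_mult2[OF A Qc zero_less_Suc] ..
    also have "A *\<^sub>v col Q 0 = e \<cdot>\<^sub>v col Q 0"
      using A v by (simp add: Q(2) mult_mat_vec[of _ ?n ?n] smult_smult_assoc mult.commute)
    also have "mat_adjoint Q *\<^sub>v (e \<cdot>\<^sub>v col Q 0) = e \<cdot>\<^sub>v col (mat_adjoint Q * Q) 0"
      using Qc mult_mat_vec[of "mat_adjoint Q" ?n ?n "col Q 0" e]
      by (auto simp: col_mult2[of _ ?n ?n _ ?n])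
    finally have col0: "col B 0 = e \<cdot>\<^sub>v unit_vec ?n 0" unfolding QQ by simp
    have B0: "B $$ (i, 0) = (if i = 0 then e else 0)" if "i < ?n" for i
      using arg_cong[OF col0, of "\<lambda>x. x $ i"] Bc that by simp
    have Bh: "B $$ (i, j) = cnj (B $$ (j, i))" if "i < ?n" "j < ?n" for i j
      using arg_cong[OF BB, of "\<lambda>x. x $$ (i, j)"] Bc that by simp
    have ec: "cnj e = e" using B0[of 0] Bh[of 0 0] by simp
    then have e: "e = complex_of_real (Re e)" by (metis Reals_cnj_iff of_real_Re)
    define A3 where "A3 = mat m m (\<lambda>(i, j). B $$ (Suc i, Suc j))"
    have A3: "A3 \<in> carrier_mat m m" "mat_adjoint A3 = A3"
      by (auto simp: A3_def Bh[symmetric] intro!: eq_matI)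
    obtain V d where V: "unitary_diag A3 V d" using Suc.IH[OF A3] by blast
    note V' = unitary_diagD[OF V A3(1)]
    have Vc: "V \<in> carrier_mat m m" "mat_adjoint V * V = 1\<^sub>m m" using V'(1) by (auto simp: unitary_mat_def)
    let ?E = "mat 1 1 (\<lambda>_. e) :: complex mat"
    \<comment> \<open>Column 0 is a multiple of the first unit vector, and Hermiticity then clears
      row 0 as well.\<close>
    have Bb: "B = four_block_mat ?E (0\<^sub>m 1 m) (0\<^sub>m m 1) A3"
      using Bc B0 Bh[of 0] ec by (auto simp: A3_def intro!: eq_matI)
    define F where "F = four_block_mat (1\<^sub>m 1) (0\<^sub>m 1 m) (0\<^sub>m m 1) V"
    have Fa: "mat_adjoint F = four_block_mat (1\<^sub>m 1) (0\<^sub>m 1 m) (0\<^sub>m m 1) (mat_adjoint V)"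
      using Vc by (auto simp: F_def intro!: eq_matI)
    have Fc: "F \<in> carrier_mat ?n ?n" using Vc four_block_carrier_mat[of "1\<^sub>m 1" 1 1 V m m] by (simp add: F_def)
    have "mat_adjoint F * F = 1\<^sub>m ?n"
      unfolding Fa unfolding F_def using Vc four_block_one_mat[of 1 m]
      by (simp add: mult_block_diag del: One_nat_def) simp
    then have F: "unitary_mat ?n F" using Fc by (simp add: unitary_mat_def)
    have "mat_adjoint (Q * F) * A * (Q * F) = mat_adjoint F * B * F"
      using A Qc Fc unfolding B_def
      by (simp add: mat_adjoint_mult[of _ ?n ?n _ ?n] assoc_mult_mat[of _ ?n ?n _ ?n _ ?n] mult_carrier_square)
    also have "\<dots> = four_block_mat ?E (0\<^sub>m 1 m) (0\<^sub>m m 1) (mat_adjoint V * A3 * V)"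
      unfolding Fa unfolding F_def Bb
      using Vc A3(1) mult_carrier_square[of "mat_adjoint V" m A3]
      by (simp add: mult_block_diag del: One_nat_def)
    \<comment> \<open>\<open>case_nat\<close> puts the new eigenvalue in front of those of
      \<open>A3\<close>.\<close>
    also have "\<dots> = mat_diag ?n (\<lambda>i. complex_of_real (case_nat (Re e) d i))"
      unfolding V'(3) using e by (auto simp: mat_diag_def intro!: eq_matI split: nat.split)
    finally show ?case using unitary_diagI[OF unitary_mat_mult[OF Q(1) F] A] by blast
  qed
  then show ?thesis using that by blast
qed

subsection \<open>Power sums\<close>

text \<open>The sign \<open>\<sigma>\<close> treats concave (\<open>\<sigma> = 1\<close>) and convex (\<open>\<sigma> = -1\<close>) powers at once. At \<open>\<alpha> = 1\<close> both
  signs are allowed, so there the inequalities become equalities; this yields \<open>\<Sum>\<^sub>m p\<^sub>m = 1\<close>.\<close>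

definition power_sign :: "real \<Rightarrow> real \<Rightarrow> bool" where
  "power_sign \<alpha> \<sigma> \<longleftrightarrow> 0 < \<alpha> \<and> (\<sigma> = 1 \<and> \<alpha> \<le> 1 \<or> \<sigma> = -1 \<and> 1 \<le> \<alpha>)"

text \<open>For positive \<open>x\<close> and \<open>y\<close> this is \<open>powr_convex\<close>.
  If one of them is 0, the claim reduces to \<open>(t * z) powr p \<le> t * z powr p\<close>, which
  follows from \<open>t powr p \<le> t\<close> on the unit interval.\<close>

lemma powr_convex_nonneg:
  assumes p: "1 \<le> p"
  shows "convex_on {0..} (\<lambda>x::real. x powr p)"
  unfolding convex_on_def
proof (intro conjI allI ballI impI)
  fix x y u v :: real
  assume x: "x \<in> {0..}" and y: "y \<in> {0..}" and uv: "0 \<le> u" "0 \<le> v" "u + v = 1"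
  have t: "t powr p \<le> t" if "0 \<le> t" "t \<le> 1" for t :: real
    using powr_le_one_le[of t p] that p by (cases "t = 0") auto
  have s: "(t * z) powr p \<le> t * z powr p" if "0 \<le> t" "t \<le> 1" "0 \<le> z" for t z :: real
    using that t[of t] by (simp add: powr_mult mult_right_mono)
  have u: "u = 1 - v" using uv by simp
  show "(u *\<^sub>R x + v *\<^sub>R y) powr p \<le> u * x powr p + v * y powr p"
    using s[of u x] s[of v y] convex_onD[OF powr_convex[OF p], of v x y] x y uv
    by (cases "x = 0"; cases "y = 0") (auto simp: u)
qed simp

text \<open>The inverse function has exponent \<open>1 / p \<ge> 1\<close> and is convex. Its
  convexity inequality at \<open>x powr p\<close> and \<open>y powr p\<close> is raised to the power
  \<open>p\<close>.\<close>

lemma powr_concave_nonneg: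
  assumes "0 < p" "p \<le> 1"
  shows "concave_on {0..} (\<lambda>x::real. x powr p)"
  unfolding concave_on_iff
proof (intro conjI allI ballI impI)
  fix x y u v :: real
  assume x: "x \<in> {0..}" and y: "y \<in> {0..}" and uv: "0 \<le> u" "0 \<le> v" "u + v = 1"
  have u: "u = 1 - v" using uv by simp
  have "(u * x powr p + v * y powr p) powr (1 / p)
      \<le> u * (x powr p) powr (1 / p) + v * (y powr p) powr (1 / p)"
    using convex_onD[OF powr_convex_nonneg[of "1 / p"], of v "x powr p" "y powr p"] uv assms by (simp add: u)
  also have "\<dots> = u * x + v * y" using x y assms by (simp add: powr_powr)
  finally have "((u * x powr p + v * y powr p) powr (1 / p)) powr p \<le> (u * x + v * y) powr p"
    using assms by (intro powr_mono2) auto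
  then show "(u *\<^sub>R x + v *\<^sub>R y) powr p \<ge> u * x powr p + v * y powr p"
    using uv assms by (simp add: powr_powr)
qed simp

lemma Jensen_powr:
  assumes s: "power_sign \<alpha> \<sigma>" and "finite J"
    and "(\<Sum>j\<in>J. w j) = 1" "\<And>j. j \<in> J \<Longrightarrow> 0 \<le> w j" "\<And>j. j \<in> J \<Longrightarrow> 0 \<le> z j"
  shows "\<sigma> * (\<Sum>j\<in>J. w j * z j powr \<alpha>) \<le> \<sigma> * (\<Sum>j\<in>J. w j * z j) powr \<alpha>"
proof -
  have J: "J \<noteq> {}" using assms(3) by auto
  from s consider "0 < \<alpha>" "\<sigma> = 1" "\<alpha> \<le> 1" | "\<sigma> = -1" "1 \<le> \<alpha>" by (auto simp: power_sign_def)
  then show ?thesis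
  proof cases
    case 1
    then show ?thesis
      using concave_on_sum[OF assms(2) J powr_concave_nonneg[of \<alpha>] assms(3), of z] assms by auto
  next
    case 2
    then show ?thesis
      using convex_on_sum[OF assms(2) J powr_convex_nonneg[of \<alpha>] assms(3), of z] assms by auto
  qed
qed

lemma sign_powr_mono:
  assumes "\<sigma> = 1 \<or> \<sigma> = -1" "0 \<le> x" "0 \<le> y" "0 \<le> r" "\<sigma> * x \<le> \<sigma> * y"
  shows "\<sigma> * x powr r \<le> \<sigma> * (y::real) powr r"
  using assms powr_mono2[of r x y] powr_mono2[of r y x] by auto

lemma power_signD:
  assumes "power_sign \<alpha> \<sigma>" shows "0 < \<alpha>" "\<sigma> = 1 \<or> \<sigma> = -1"
  using assms by (auto simp: power_sign_def)

text \<open>Normalise each vector \<open>y j\<close> by its size \<open>N j\<close>, and apply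
  Jensen at every index \<open>i\<close> with the weights \<open>N j / T\<close>. After summation
  over \<open>i\<close> each normalised vector of nonzero size contributes just its weight, so the
  left side becomes 1; clearing \<open>T\<close> gives the claim.\<close>

lemma Minkowski_powr:
  fixes y :: "'j \<Rightarrow> 'i \<Rightarrow> real"
  assumes s: "power_sign \<alpha> \<sigma>" and fin: "finite I" "finite J"
    and y: "\<And>i j. i \<in> I \<Longrightarrow> j \<in> J \<Longrightarrow> 0 \<le> y j i"
  shows "\<sigma> * (\<Sum>j\<in>J. (\<Sum>i\<in>I. y j i powr \<alpha>) powr (1 / \<alpha>))
       \<le> \<sigma> * (\<Sum>i\<in>I. (\<Sum>j\<in>J. y j i) powr \<alpha>) powr (1 / \<alpha>)"
proof -
  note \<alpha> = power_signD(1)[OF s] and sg = power_signD(2)[OF s]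
  define N where "N j = (\<Sum>i\<in>I. y j i powr \<alpha>) powr (1 / \<alpha>)" for j
  have Na: "N j powr \<alpha> = (\<Sum>i\<in>I. y j i powr \<alpha>)" for j
    using \<alpha> by (simp add: N_def powr_powr sum_nonneg)
  have N0: "0 \<le> N j" for j by (simp add: N_def)
  \<comment> \<open>A vector of size 0 vanishes, so the default value \<open>y j i / 0 = 0\<close>
    does no harm below.\<close>
  have yN: "y j i = 0" if "N j = 0" "i \<in> I" "j \<in> J" for i j
    using Na[of j] that fin \<alpha> by (auto simp: sum_nonneg_eq_0_iff)
  define T where "T = (\<Sum>j\<in>J. N j)"
  have T0: "0 \<le> T" by (simp add: T_def N0 sum_nonneg)
  show ?thesis
  proof (cases "T = 0")
    case True
    then have "N j = 0" if "j \<in> J" for j using that fin N0 by (auto simp: T_def sum_nonneg_eq_0_iff)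
    then have "(\<Sum>j\<in>J. y j i) = 0" if "i \<in> I" for i using yN that by auto
    then have "(\<Sum>i\<in>I. (\<Sum>j\<in>J. y j i) powr \<alpha>) = 0" by simp
    with True show ?thesis by (simp add: T_def N_def)
  next
    case False
    then have T: "0 < T" using T0 by simp
    have "\<sigma> * (\<Sum>j\<in>J. N j / T * (y j i / N j) powr \<alpha>) \<le> \<sigma> * ((\<Sum>j\<in>J. y j i) / T) powr \<alpha>" if i: "i \<in> I" for i
    proof -
      have "(\<Sum>j\<in>J. N j / T * (y j i / N j)) = (\<Sum>j\<in>J. y j i) / T"
        unfolding sum_divide_distrib using yN[OF _ i] by (intro sum.cong) auto
      moreover have "(\<Sum>j\<in>J. N j / T) = 1" using T by (simp add: T_def flip: sum_divide_distrib)
      ultimately show ?thesis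
        using Jensen_powr[OF s fin(2), of "\<lambda>j. N j / T" "\<lambda>j. y j i / N j"] T N0 y[OF i]
        by simp
    qed
    then have "(\<Sum>i\<in>I. \<sigma> * (\<Sum>j\<in>J. N j / T * (y j i / N j) powr \<alpha>))
      \<le> (\<Sum>i\<in>I. \<sigma> * ((\<Sum>j\<in>J. y j i) / T) powr \<alpha>)" by (rule sum_mono)
    then have "\<sigma> * (\<Sum>i\<in>I. \<Sum>j\<in>J. N j / T * (y j i / N j) powr \<alpha>)
      \<le> \<sigma> * (\<Sum>i\<in>I. ((\<Sum>j\<in>J. y j i) / T) powr \<alpha>)" by (simp add: sum_distrib_left)
    also have "(\<Sum>i\<in>I. \<Sum>j\<in>J. N j / T * (y j i / N j) powr \<alpha>) = 
        (\<Sum>j\<in>J. N j / T * (\<Sum>i\<in>I. (y j i / N j) powr \<alpha>))"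
      by (subst sum.swap) (simp add: sum_distrib_left)
    also have "\<dots> = (\<Sum>j\<in>J. N j / T)"
    proof (rule sum.cong[OF refl])
      fix j assume j: "j \<in> J"
      have "(\<Sum>i\<in>I. (y j i / N j) powr \<alpha>) = (\<Sum>i\<in>I. y j i powr \<alpha> / N j powr \<alpha>)"
        using y[OF _ j] N0 by (intro sum.cong) (auto simp: powr_divide)
      also have "\<dots> = N j powr \<alpha> / N j powr \<alpha>" by (simp add: Na flip: sum_divide_distrib)
      \<comment> \<open>If \<open>N j = 0\<close>, the prefactor \<open>N j / T\<close> makes both
        sides 0.\<close>
      finally show "N j / T * (\<Sum>i\<in>I. (y j i / N j) powr \<alpha>) = N j / T" by simp
    qed
    also have "\<dots> = 1" using T by (simp add: T_def flip: sum_divide_distrib)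
    also have "(\<Sum>i\<in>I. ((\<Sum>j\<in>J. y j i) / T) powr \<alpha>) = (\<Sum>i\<in>I. (\<Sum>j\<in>J. y j i) powr \<alpha>) / T powr \<alpha>"
      unfolding sum_divide_distrib[of _ I] using T y by (intro sum.cong) (auto simp: powr_divide sum_nonneg)
    finally have "\<sigma> * T powr \<alpha> \<le> \<sigma> * (\<Sum>i\<in>I. (\<Sum>j\<in>J. y j i) powr \<alpha>)"
      using T by (simp add: pos_le_divide_eq)
    then have "\<sigma> * (T powr \<alpha>) powr (1 / \<alpha>) \<le> \<sigma> * (\<Sum>i\<in>I. (\<Sum>j\<in>J. y j i) powr \<alpha>) powr (1 / \<alpha>)"
      using \<alpha> sg by (intro sign_powr_mono) (auto intro: sum_nonneg)
    then show ?thesis using T \<alpha> by (simp add: powr_powr T_def N_def)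
  qed
qed

subsection \<open>The Minkowski inequality for positive matrices\<close>

text \<open>Positivity is expressed by a nonnegative spectrum because the power sums below run over
  eigenvalues.\<close>

definition psd_mat :: "nat \<Rightarrow> complex mat \<Rightarrow> bool" where
  "psd_mat n X \<longleftrightarrow> X \<in> carrier_mat n n \<and> (\<exists>V e. unitary_diag X V e \<and> (\<forall>i<n. 0 \<le> e i))"

lemma quad_form_index:
  fixes U X :: "complex mat"
  assumes "U \<in> carrier_mat n m" "X \<in> carrier_mat n n" "i < m" "j < m"
  shows "(mat_adjoint U * X * U) $$ (i, j) = (\<Sum>l<n. \<Sum>k<n. cnj (U $$ (k, i)) * X $$ (k, l) * U $$ (l, j))"
  using assms by (simp del: index_mult_mat(1) add: mult_index_sum sum_distrib_right)

lemma conj_diag_index: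
  assumes W: "W \<in> carrier_mat n m" and "i < n"
  shows "(W * mat_diag m (\<lambda>k. complex_of_real (e k)) * mat_adjoint W) $$ (i, i)
    = complex_of_real (\<Sum>k<m. (cmod (W $$ (i, k)))\<^sup>2 * e k)"
proof -
  have "(W * mat_diag m (\<lambda>k. complex_of_real (e k)) * mat_adjoint W) $$ (i, i)
    = (\<Sum>k<m. W $$ (i, k) * complex_of_real (e k) * cnj (W $$ (i, k)))"
    unfolding mat_diag_mult_right[OF W]
    using assms by (simp del: index_mult_mat(1) add: mult_index_sum)
  also have "\<dots> = complex_of_real (\<Sum>k<m. (cmod (W $$ (i, k)))\<^sup>2 * e k)"
    unfolding of_real_sum
    by (intro sum.cong refl) (simp add: complex_norm_square mult_ac del: of_real_power)
  finally show ?thesis .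
qed

lemma gram_diag:
  assumes W: "W \<in> carrier_mat n m" and "i < n"
  shows "(W * mat_adjoint W) $$ (i, i) = complex_of_real (\<Sum>k<m. (cmod (W $$ (i, k)))\<^sup>2)"
proof -
  have "mat_diag m (\<lambda>k. complex_of_real 1) = 1\<^sub>m m" by (auto simp: mat_diag_def intro!: eq_matI)
  then show ?thesis using conj_diag_index[OF assms, of "\<lambda>_. 1"] W by simp
qed

text \<open>With \<open>unitary_col_sum\<close> this says that the squared moduli of the entries of
  a unitary matrix are doubly stochastic; they serve as weights in Jensen's inequality.\<close>

lemma unitary_row_sum:
  assumes "unitary_mat n W" "i < n"
  shows "(\<Sum>k<n. (cmod (W $$ (i, k)))\<^sup>2) = 1"
proof -
  have "complex_of_real (\<Sum>k<n. (cmod (W $$ (i, k)))\<^sup>2) = complex_of_real 1"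
    using gram_diag[of W n n i] unitary_mat_adjoint(2)[OF assms(1)] assms by (simp add: unitary_mat_def)
  then show ?thesis by (simp only: of_real_eq_iff)
qed

lemma unitary_col_sum:
  assumes "unitary_mat n W" "k < n"
  shows "(\<Sum>i<n. (cmod (W $$ (i, k)))\<^sup>2) = 1"
  using unitary_row_sum[OF unitary_mat_adjoint(1)[OF assms(1)] assms(2)] assms
  by (auto simp: unitary_mat_def)

lemma unitary_diag_conj_index:
  assumes "unitary_diag X V e" "X \<in> carrier_mat n n" "unitary_mat n U" "i < n"
  shows "(mat_adjoint U * X * U) $$ (i, i)
    = complex_of_real (\<Sum>k<n. (cmod ((mat_adjoint U * V) $$ (i, k)))\<^sup>2 * e k)"
proof -
  note V = unitary_diagD[OF assms(1,2)]
  have c: "U \<in> carrier_mat n n" "V \<in> carrier_mat n n" using V(1) assms(3) by (auto simp: unitary_mat_def)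
  have d: "mat_diag n (\<lambda>i. complex_of_real (e i)) \<in> carrier_mat n n" by simp
  have a: "mat_adjoint U * (V * D * mat_adjoint V) * U = (mat_adjoint U * V) * D * mat_adjoint (mat_adjoint U * V)"
    if "D \<in> carrier_mat n n" for D
    using c that by (simp add: mat_adjoint_mult[of _ n n _ n] assoc_mult_mat[of _ n n _ n _ n] mult_carrier_square)
  show ?thesis unfolding V(2) a[OF d]
    using c assms(4) by (intro conj_diag_index) auto
qed

text \<open>In the basis \<open>U\<close> the diagonal entries of \<open>X\<close> are averages of
  its eigenvalues, with weights the squared moduli of the entries of \<open>W\<close>. Unit row sums
  allow Jensen in every entry, and unit column sums recover the full power sum of the
  eigenvalues.\<close>

theorem Peierls:
  assumes s: "power_sign \<alpha> \<sigma>" and X: "unitary_diag X V e" "X \<in> carrier_mat n n"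
    and e: "\<And>k. k < n \<Longrightarrow> 0 \<le> e k" and U: "unitary_mat n U"
  shows "\<sigma> * (\<Sum>k<n. e k powr \<alpha>) \<le> \<sigma> * (\<Sum>i<n. Re ((mat_adjoint U * X * U) $$ (i, i)) powr \<alpha>)"
proof -
  define W where "W = mat_adjoint U * V"
  have W: "unitary_mat n W" unfolding W_def
    using unitary_mat_mult unitary_mat_adjoint(1)[OF U] unitary_diagD(1)[OF X] by blast
  have r: "Re ((mat_adjoint U * X * U) $$ (i, i)) = (\<Sum>k<n. (cmod (W $$ (i, k)))\<^sup>2 * e k)" if "i < n" for i
    using unitary_diag_conj_index[OF X U that] by (simp add: W_def)
  have "(\<Sum>k<n. e k powr \<alpha>) = (\<Sum>k<n. (\<Sum>i<n. (cmod (W $$ (i, k)))\<^sup>2) * e k powr \<alpha>)"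
    using unitary_col_sum[OF W] by simp
  also have "\<dots> = (\<Sum>i<n. \<Sum>k<n. (cmod (W $$ (i, k)))\<^sup>2 * e k powr \<alpha>)"
    by (subst sum.swap) (simp add: sum_distrib_right)
  also have "\<sigma> * \<dots> = (\<Sum>i<n. \<sigma> * (\<Sum>k<n. (cmod (W $$ (i, k)))\<^sup>2 * e k powr \<alpha>))"
    by (simp add: sum_distrib_left)
  also have "\<dots> \<le> (\<Sum>i<n. \<sigma> * (\<Sum>k<n. (cmod (W $$ (i, k)))\<^sup>2 * e k) powr \<alpha>)"
    using e unitary_row_sum[OF W] by (intro sum_mono Jensen_powr[OF s]) auto
  also have "\<dots> = \<sigma> * (\<Sum>i<n. Re ((mat_adjoint U * X * U) $$ (i, i)) powr \<alpha>)"
    by (simp add: sum_distrib_left r)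
  finally show ?thesis .
qed

lemma psd_quad_nonneg:
  assumes "psd_mat n X" "unitary_mat n U" "i < n"
  shows "0 \<le> Re ((mat_adjoint U * X * U) $$ (i, i))"
proof -
  obtain V e where "unitary_diag X V e" "\<forall>i<n. 0 \<le> e i" "X \<in> carrier_mat n n"
    using assms(1) by (auto simp: psd_mat_def)
  then show ?thesis using unitary_diag_conj_index[of X V e n U i] assms by (auto intro: sum_nonneg)
qed

section \<open>Traces of matrix powers\<close>

definition power_trace :: "real \<Rightarrow> complex mat \<Rightarrow> real" where
  "power_trace \<alpha> X = Re (mat_trace (mat_powr X \<alpha>))"

lemma power_trace_eq:
  assumes X: "unitary_diag X V e" "X \<in> carrier_mat n n"
  shows "power_trace \<alpha> X = (\<Sum>k<n. e k powr \<alpha>)"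
proof -
  note V = unitary_diagD[OF X]
  have c: "V \<in> carrier_mat n n" using V(1) by (simp add: unitary_mat_def)
  have "mat_trace (mat_powr X \<alpha>) = complex_of_real (\<Sum>i<n. \<Sum>k<n. (cmod (V $$ (i, k)))\<^sup>2 * e k powr \<alpha>)"
    using X(2) c by (simp del: index_mult_mat(1) add: mat_powr_eq[OF X(1)] mat_trace_def conj_diag_index[OF c])
  also have "(\<Sum>i<n. \<Sum>k<n. (cmod (V $$ (i, k)))\<^sup>2 * e k powr \<alpha>) = (\<Sum>k<n. e k powr \<alpha>)"
    by (subst sum.swap) (simp add: unitary_col_sum[OF V(1)] flip: sum_distrib_right)
  finally show ?thesis by (simp add: power_trace_def)
qed

text \<open>The identity \<open>x powr 1 = x\<close> holds for nonnegative \<open>x\<close>, so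
  positivity of the spectrum enters here.\<close>

lemma power_trace_1:
  assumes "psd_mat n X"
  shows "power_trace 1 X = Re (mat_trace X)"
proof -
  obtain V e where X: "unitary_diag X V e" "\<forall>i<n. 0 \<le> e i" "X \<in> carrier_mat n n"
    using assms by (auto simp: psd_mat_def)
  have "mat_diag (dim_row X) (\<lambda>i. complex_of_real (e i powr 1)) = mat_diag n (\<lambda>i. complex_of_real (e i))"
    using X by (auto simp: mat_diag_def intro!: eq_matI)
  then have "mat_powr X 1 = X"
    using unitary_diagD(2)[OF X(1,3)] mat_powr_eq[OF X(1), of 1] by metis
  then show ?thesis by (simp add: power_trace_def)
qed

text \<open>On positive matrices this is the Schatten norm for \<alpha> \<ge> 1 and a quasi-norm for
  \<alpha> < 1. The outer exponent makes it homogeneous of degree 1, so that probabilities factor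
  out linearly.\<close>

definition schatten :: "real \<Rightarrow> complex mat \<Rightarrow> real" where
  "schatten \<alpha> X = power_trace \<alpha> X powr (1 / \<alpha>)"

text \<open>Work in an eigenbasis \<open>U\<close> of \<open>Y\<close>. Each eigenvalue of
  \<open>Y\<close> is the sum over \<open>j\<close> of the corresponding diagonal entries
  \<open>y j i\<close> of \<open>X j\<close>. \<open>Peierls\<close> compares each
  \<open>X j\<close> with its diagonal, and \<open>Minkowski_powr\<close> handles the
  diagonals.\<close>

theorem schatten_Minkowski:
  assumes s: "power_sign \<alpha> \<sigma>" and fin: "finite J"
    and X: "\<And>j. j \<in> J \<Longrightarrow> psd_mat n (X j)" and Y: "psd_mat n Y"
    and sum: "\<And>i k. i < n \<Longrightarrow> k < n \<Longrightarrow> Y $$ (i, k) = (\<Sum>j\<in>J. X j $$ (i, k))"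
  shows "\<sigma> * (\<Sum>j\<in>J. schatten \<alpha> (X j)) \<le> \<sigma> * schatten \<alpha> Y"
proof -
  note \<alpha> = power_signD(1)[OF s] and sg = power_signD(2)[OF s]
  obtain U d where Yd: "unitary_diag Y U d" "Y \<in> carrier_mat n n"
    using Y by (auto simp: psd_mat_def)
  note U = unitary_diagD[OF Yd]
  have Uc: "U \<in> carrier_mat n n" using U(1) by (simp add: unitary_mat_def)
  define y where "y j i = Re ((mat_adjoint U * X j * U) $$ (i, i))" for j i
  have Xc: "X j \<in> carrier_mat n n" if "j \<in> J" for j using X[OF that] by (simp add: psd_mat_def)
  have d: "d i = (\<Sum>j\<in>J. y j i)" if i: "i < n" for i
  proof -
    have "complex_of_real (d i) = (mat_adjoint U * Y * U) $$ (i, i)" using U(3) i by (simp add: mat_diag_def)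
    also have "\<dots> = (\<Sum>l<n. \<Sum>k<n. \<Sum>j\<in>J. cnj (U $$ (k, i)) * X j $$ (k, l) * U $$ (l, i))"
      using quad_form_index[OF Uc Yd(2) i i] by (simp add: sum sum_distrib_left sum_distrib_right)
    also have "\<dots> = (\<Sum>l<n. \<Sum>j\<in>J. \<Sum>k<n. cnj (U $$ (k, i)) * X j $$ (k, l) * U $$ (l, i))"
      by (intro sum.cong refl sum.swap)
    also have "\<dots> = (\<Sum>j\<in>J. \<Sum>l<n. \<Sum>k<n. cnj (U $$ (k, i)) * X j $$ (k, l) * U $$ (l, i))"
      by (rule sum.swap)
    also have "\<dots> = (\<Sum>j\<in>J. (mat_adjoint U * X j * U) $$ (i, i))"
      by (intro sum.cong refl) (simp only: quad_form_index[OF Uc Xc i i])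
    finally show ?thesis unfolding y_def by (metis Re_complex_of_real Re_sum)
  qed
  have "\<sigma> * (\<Sum>j\<in>J. schatten \<alpha> (X j)) = (\<Sum>j\<in>J. \<sigma> * schatten \<alpha> (X j))" by (simp add: sum_distrib_left)
  also have "\<dots> \<le> (\<Sum>j\<in>J. \<sigma> * (\<Sum>i<n. y j i powr \<alpha>) powr (1 / \<alpha>))"
  proof (rule sum_mono)
    fix j assume j: "j \<in> J"
    obtain V e where Xj: "unitary_diag (X j) V e" "\<forall>i<n. 0 \<le> e i" using X[OF j] by (auto simp: psd_mat_def)
    show "\<sigma> * schatten \<alpha> (X j) \<le> \<sigma> * (\<Sum>i<n. y j i powr \<alpha>) powr (1 / \<alpha>)"
      unfolding schatten_def power_trace_eq[OF Xj(1) Xc[OF j]] y_def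
      using \<alpha> Xj(2) sg by (intro sign_powr_mono Peierls[OF s Xj(1) Xc[OF j] _ U(1)]) (auto intro: sum_nonneg)
  qed
  also have "\<dots> = \<sigma> * (\<Sum>j\<in>J. (\<Sum>i<n. y j i powr \<alpha>) powr (1 / \<alpha>))" by (simp add: sum_distrib_left)
  also have "\<dots> \<le> \<sigma> * (\<Sum>i<n. (\<Sum>j\<in>J. y j i) powr \<alpha>) powr (1 / \<alpha>)"
    using psd_quad_nonneg[OF X U(1)] fin by (intro Minkowski_powr[OF s]) (auto simp: y_def)
  also have "\<dots> = \<sigma> * schatten \<alpha> Y"
    unfolding schatten_def power_trace_eq[OF Yd] using d by simp
  finally show ?thesis .
qed

section \<open>Gram matrices and their spectra\<close>

text \<open>In an eigenbasis \<open>U\<close> every eigenvalue is a diagonal entry of the Gram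
  matrix of \<open>mat_adjoint U * N\<close>, hence a sum of squared moduli.\<close>

lemma psd_mat_gram:
  assumes N: "N \<in> carrier_mat n m"
  shows "psd_mat n (N * mat_adjoint N)"
proof -
  let ?X = "N * mat_adjoint N"
  have X: "?X \<in> carrier_mat n n" using N by simp
  have "mat_adjoint ?X = ?X" using N by (simp add: mat_adjoint_mult[of _ n m _ n])
  then obtain U d where Ud: "unitary_diag ?X U d" using hermitian_unitary_diag[OF X] by blast
  note U = unitary_diagD[OF Ud X]
  have Uc: "U \<in> carrier_mat n n" using U(1) by (simp add: unitary_mat_def)
  note c = mat_adjoint_carrier[OF Uc] N mat_adjoint_carrier[OF N]
  have "0 \<le> d i" if i: "i < n" for i
  proof -
    have "mat_adjoint U * ?X * U = (mat_adjoint U * N) * mat_adjoint (mat_adjoint U * N)"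
      using assoc_mult_mat[OF c(1,2,3), symmetric] assoc_mult_mat[OF mult_carrier_mat[OF c(1,2)] c(3) Uc]
        mat_adjoint_mult[OF c(1,2)] by simp
    then have "(mat_adjoint U * ?X * U) $$ (i, i) = complex_of_real (\<Sum>k<m. (cmod ((mat_adjoint U * N) $$ (i, k)))\<^sup>2)"
      using gram_diag[OF mult_carrier_mat[OF c(1,2)] i] by (simp only:)
    moreover have "(mat_adjoint U * ?X * U) $$ (i, i) = complex_of_real (d i)"
      using U(3) i by (simp add: mat_diag_def)
    ultimately have "d i = (\<Sum>k<m. (cmod ((mat_adjoint U * N) $$ (i, k)))\<^sup>2)"
      by (metis of_real_eq_iff)
    then show ?thesis by (simp add: sum_nonneg)
  qed
  then show ?thesis using X Ud by (auto simp: psd_mat_def)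
qed

lemma psd_matE:
  assumes "psd_mat n X"
  obtains U d where "unitary_diag X U d" "\<And>i. i < n \<Longrightarrow> 0 \<le> d i" "X \<in> carrier_mat n n"
  using assms by (auto simp: psd_mat_def)

text \<open>If \<open>U\<close> and \<open>W\<close> diagonalise \<open>N N\<^sup>\<dagger>\<close> and \<open>N\<^sup>\<dagger> N\<close>, then the entry \<open>T\<^sub>k\<^sub>l\<close> of \<open>T = U\<^sup>\<dagger> N W\<close> vanishes unless
  \<open>d\<^sub>k = e\<^sub>l\<close>, and the weights \<open>\<bar>T\<^sub>k\<^sub>l\<bar>\<^sup>2\<close> have row sums \<open>d\<^sub>k\<close> and column sums \<open>e\<^sub>l\<close>.\<close>

theorem power_trace_gram_adjoint:
  assumes N: "N \<in> carrier_mat n m"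
  shows "power_trace \<alpha> (N * mat_adjoint N) = power_trace \<alpha> (mat_adjoint N * N)"
proof -
  obtain U d where Ud: "unitary_diag (N * mat_adjoint N) U d" "\<And>i. i < n \<Longrightarrow> 0 \<le> d i"
      "N * mat_adjoint N \<in> carrier_mat n n"
    using psd_matE[OF psd_mat_gram[OF N]] by blast
  have "psd_mat m (mat_adjoint N * N)" using psd_mat_gram[of "mat_adjoint N" m n] N by simp
  then obtain W e where We: "unitary_diag (mat_adjoint N * N) W e" "\<And>i. i < m \<Longrightarrow> 0 \<le> e i"
      "mat_adjoint N * N \<in> carrier_mat m m"
    using psd_matE by blast
  note U = unitary_diagD[OF Ud(1,3)] and W = unitary_diagD[OF We(1,3)]
  have Uc: "U \<in> carrier_mat n n" and Wc: "W \<in> carrier_mat m m"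
    using U(1) W(1) by (auto simp: unitary_mat_def)
  define T where "T = mat_adjoint U * N * W"
  have T: "T \<in> carrier_mat n m" using Uc N Wc unfolding T_def
    by (intro mult_carrier_mat[of _ n m] mult_carrier_mat[of _ n n]) auto
  have Ta: "mat_adjoint T = mat_adjoint W * mat_adjoint N * U"
    using Uc N Wc mult_carrier_mat[of "mat_adjoint U" n n N m] unfolding T_def
    by (simp add: mat_adjoint_mult[of _ n m _ m] mat_adjoint_mult[of _ n n _ m] assoc_mult_mat[of _ m m _ n _ n])
  note c = Uc Wc N mat_adjoint_carrier[OF Uc] mat_adjoint_carrier[OF Wc] mat_adjoint_carrier[OF N]
  \<comment> \<open>The inner factor \<open>W * mat_adjoint W\<close> is the identity, which leaves
    \<open>N * mat_adjoint N\<close> in its eigenbasis \<open>U\<close>.\<close>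
  have "T * mat_adjoint T = mat_adjoint U * N * (W * mat_adjoint W) * mat_adjoint N * U"
    unfolding Ta unfolding T_def using c
    by (smt (verit) assoc_mult_mat mult_carrier_mat)
  then have TT: "T * mat_adjoint T = mat_diag n (\<lambda>i. complex_of_real (d i))"
    using U(3) c unfolding unitary_mat_adjoint(2)[OF W(1)]
    by (smt (verit) assoc_mult_mat mult_carrier_mat right_mult_one_mat)
  have "mat_adjoint T * T = mat_adjoint W * mat_adjoint N * (U * mat_adjoint U) * N * W"
    unfolding Ta unfolding T_def using c
    by (smt (verit) assoc_mult_mat mult_carrier_mat)
  then have TT': "mat_adjoint T * T = mat_diag m (\<lambda>i. complex_of_real (e i))"
    using W(3) c unfolding unitary_mat_adjoint(2)[OF U(1)]
    by (smt (verit) assoc_mult_mat mult_carrier_mat right_mult_one_mat)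
  \<comment> \<open>Both sides equal \<open>T * mat_adjoint T * T\<close>. Comparing entries shows
    that \<open>T\<close> links equal eigenvalues only.\<close>
  have "T * mat_diag m (\<lambda>i. complex_of_real (e i)) = mat_diag n (\<lambda>i. complex_of_real (d i)) * T"
    unfolding TT[symmetric] TT'[symmetric] using T assoc_mult_mat[of T n m "mat_adjoint T" n T m] by simp
  then have comm: "T $$ (k, l) = 0 \<or> d k = e l" if "k < n" "l < m" for k l
    using arg_cong[of _ _ "\<lambda>x. x $$ (k, l)"] that T
    by (fastforce simp: mat_diag_mult_right[OF T] mat_diag_mult_left[OF T])
  have row: "d k = (\<Sum>l<m. (cmod (T $$ (k, l)))\<^sup>2)" if "k < n" for k
  proof -
    have "complex_of_real (d k) = complex_of_real (\<Sum>l<m. (cmod (T $$ (k, l)))\<^sup>2)"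
      using gram_diag[OF T that] that unfolding TT by (simp add: mat_diag_def)
    then show ?thesis by (simp only: of_real_eq_iff)
  qed
  have col: "e l = (\<Sum>k<n. (cmod (T $$ (k, l)))\<^sup>2)" if "l < m" for l
  proof -
    have "complex_of_real (e l) = complex_of_real (\<Sum>k<n. (cmod (mat_adjoint T $$ (l, k)))\<^sup>2)"
      using gram_diag[of "mat_adjoint T" m n l] T that TT' by (simp add: mat_diag_def)
    then have "e l = (\<Sum>k<n. (cmod (mat_adjoint T $$ (l, k)))\<^sup>2)" by (simp only: of_real_eq_iff)
    then show ?thesis using T that by simp
  qed
  \<comment> \<open>One factor \<open>x\<close> is split off to be expanded into the weights. At 0
    both sides vanish, for every exponent.\<close>
  have base: "x powr \<alpha> = x * x powr (\<alpha> - 1)" if "0 \<le> x" for x :: real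
    using powr_mult_base[OF that, of "\<alpha> - 1"] by simp
  have "(\<Sum>k<n. d k powr \<alpha>) = (\<Sum>k<n. d k * d k powr (\<alpha> - 1))" using Ud(2) by (simp add: base)
  also have "\<dots> = (\<Sum>k<n. \<Sum>l<m. (cmod (T $$ (k, l)))\<^sup>2 * d k powr (\<alpha> - 1))"
    by (intro sum.cong refl) (metis row sum_distrib_right lessThan_iff)
  \<comment> \<open>The eigenvalue may be exchanged wherever the weight is nonzero.\<close>
  also have "\<dots> = (\<Sum>k<n. \<Sum>l<m. (cmod (T $$ (k, l)))\<^sup>2 * e l powr (\<alpha> - 1))"
    using comm by (intro sum.cong refl) fastforce
  also have "\<dots> = (\<Sum>l<m. \<Sum>k<n. (cmod (T $$ (k, l)))\<^sup>2 * e l powr (\<alpha> - 1))" by (rule sum.swap)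
  also have "\<dots> = (\<Sum>l<m. e l * e l powr (\<alpha> - 1))"
    by (intro sum.cong refl) (metis col sum_distrib_right lessThan_iff)
  also have "\<dots> = (\<Sum>l<m. e l powr \<alpha>)" using We(2) by (simp add: base)
  finally show ?thesis using power_trace_eq[OF Ud(1,3)] power_trace_eq[OF We(1,3)] by simp
qed

lemma power_trace_nonneg: "psd_mat n X \<Longrightarrow> 0 \<le> power_trace \<alpha> X"
  by (auto elim!: psd_matE simp: power_trace_eq intro!: sum_nonneg)

text \<open>Either side says that all eigenvalues are 0. With exponent 1 this relates vanishing
  power traces to vanishing probability.\<close>

lemma power_trace_zero_iff:
  assumes "psd_mat n X"
  shows "power_trace \<alpha> X = 0 \<longleftrightarrow> power_trace \<beta> X = 0"
  using assms by (auto elim!: psd_matE simp: power_trace_eq sum_nonneg_eq_0_iff)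

lemma power_trace_smult:
  assumes X: "psd_mat n X" and "0 \<le> c"
  shows "power_trace \<alpha> (complex_of_real c \<cdot>\<^sub>m X) = c powr \<alpha> * power_trace \<alpha> X"
proof -
  obtain U d where Ud: "unitary_diag X U d" "\<And>i. i < n \<Longrightarrow> 0 \<le> d i" "X \<in> carrier_mat n n"
    using psd_matE[OF X] by blast
  note U = unitary_diagD[OF Ud(1,3)]
  have Uc: "U \<in> carrier_mat n n" using U(1) by (simp add: unitary_mat_def)
  have "mat_adjoint U * (complex_of_real c \<cdot>\<^sub>m X) * U = complex_of_real c \<cdot>\<^sub>m (mat_adjoint U * X * U)"
    using Uc Ud(3) mult_carrier_mat[of "mat_adjoint U" n n X n]
    by (simp add: mult_smult_distrib[of _ n n _ n] mult_smult_assoc_mat[of _ n n _ n])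
  also have "\<dots> = mat_diag n (\<lambda>i. complex_of_real (c * d i))"
    unfolding U(3) by (auto simp: mat_diag_def intro!: eq_matI)
  finally have "unitary_diag (complex_of_real c \<cdot>\<^sub>m X) U (\<lambda>i. c * d i)"
    using U(1) Ud(3) by (intro unitary_diagI) auto
  then have "power_trace \<alpha> (complex_of_real c \<cdot>\<^sub>m X) = (\<Sum>k<n. (c * d k) powr \<alpha>)"
    using Ud(3) by (intro power_trace_eq) auto
  also have "\<dots> = c powr \<alpha> * power_trace \<alpha> X"
    using assms Ud(2) by (simp add: power_trace_eq[OF Ud(1,3)] sum_distrib_left powr_mult)
  finally show ?thesis .
qed

text \<open>In terms of singular values this is the square of the Schatten functional of
  \<open>N\<close> with exponent \<open>2 * \<alpha>\<close>. It therefore does not distinguish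
  \<open>N\<close> from its adjoint.\<close>

definition gram_schatten :: "real \<Rightarrow> complex mat \<Rightarrow> real" where
  "gram_schatten \<alpha> N = schatten \<alpha> (N * mat_adjoint N)"

lemma gram_schatten_adjoint:
  "gram_schatten \<alpha> (mat_adjoint N) = gram_schatten \<alpha> N"
  using power_trace_gram_adjoint[of N "dim_row N" "dim_col N"]
  by (simp add: gram_schatten_def schatten_def)

subsection \<open>Local measurements\<close>

text \<open>Completeness of the family makes \<open>mat_adjoint N * N\<close> the sum of the Gram
  matrices \<open>mat_adjoint (X j * N) * (X j * N)\<close>. These all have size \<open>m\<close>,
  whatever the output dimensions \<open>r j\<close>, so \<open>schatten_Minkowski\<close> applies to
  them.\<close>

lemma gram_schatten_measurement:
  assumes s: "power_sign \<alpha> \<sigma>" and fin: "finite J"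
    and X: "\<And>j. j \<in> J \<Longrightarrow> X j \<in> carrier_mat (r j) b"
    and id: "\<And>i k. i < b \<Longrightarrow> k < b \<Longrightarrow> (\<Sum>j\<in>J. (mat_adjoint (X j) * X j) $$ (i, k)) = (if i = k then 1 else 0)"
    and N: "N \<in> carrier_mat b m"
  shows "\<sigma> * (\<Sum>j\<in>J. gram_schatten \<alpha> (X j * N)) \<le> \<sigma> * gram_schatten \<alpha> N"
proof -
  have Na: "mat_adjoint N \<in> carrier_mat m b" using N by simp
  have eq: "gram_schatten \<alpha> (X j * N) = schatten \<alpha> (mat_adjoint (X j * N) * (X j * N))" if "j \<in> J" for j
    using gram_schatten_adjoint[of \<alpha> "X j * N"] by (simp add: gram_schatten_def)
  have eqN: "gram_schatten \<alpha> N = schatten \<alpha> (mat_adjoint N * N)"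
    using gram_schatten_adjoint[of \<alpha> N] by (simp add: gram_schatten_def)
  have Xc: "mat_adjoint (X j) * X j \<in> carrier_mat b b" if "j \<in> J" for j
    using mult_carrier_mat[OF mat_adjoint_carrier[OF X[OF that]] X[OF that]] .
  have q: "mat_adjoint (X j * N) * (X j * N) = mat_adjoint N * (mat_adjoint (X j) * X j) * N" if "j \<in> J" for j
  proof -
    note c = X[OF that] mat_adjoint_carrier[OF X[OF that]]
    show ?thesis
      unfolding mat_adjoint_mult[OF c(1) N] assoc_mult_mat[OF Na c(2) mult_carrier_mat[OF c(1) N]]
        assoc_mult_mat[OF Na Xc[OF that] N] assoc_mult_mat[OF c(2,1) N] ..
  qed
  have "\<sigma> * (\<Sum>j\<in>J. schatten \<alpha> (mat_adjoint (X j * N) * (X j * N))) \<le> \<sigma> * schatten \<alpha> (mat_adjoint N * N)"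
  proof (rule schatten_Minkowski[OF s fin, of m])
    show "psd_mat m (mat_adjoint (X j * N) * (X j * N))" if "j \<in> J" for j
      using psd_mat_gram[of "mat_adjoint (X j * N)" m "r j"] X[OF that] N by simp
    show "psd_mat m (mat_adjoint N * N)" using psd_mat_gram[OF Na] by simp
    fix i k assume i: "i < m" and k: "k < m"
    have "(\<Sum>j\<in>J. (mat_adjoint (X j * N) * (X j * N)) $$ (i, k))
      = (\<Sum>j\<in>J. \<Sum>l<b. \<Sum>p<b. cnj (N $$ (p, i)) * (mat_adjoint (X j) * X j) $$ (p, l) * N $$ (l, k))"
      by (intro sum.cong refl) (simp only: q quad_form_index[OF N Xc i k])
    also have "\<dots> = (\<Sum>l<b. \<Sum>j\<in>J. \<Sum>p<b. cnj (N $$ (p, i)) * (mat_adjoint (X j) * X j) $$ (p, l) * N $$ (l, k))"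
      by (rule sum.swap)
    also have "\<dots> = (\<Sum>l<b. \<Sum>p<b. \<Sum>j\<in>J. cnj (N $$ (p, i)) * (mat_adjoint (X j) * X j) $$ (p, l) * N $$ (l, k))"
      by (intro sum.cong refl sum.swap)
    also have "\<dots> = (\<Sum>l<b. \<Sum>p<b. cnj (N $$ (p, i)) * (\<Sum>j\<in>J. (mat_adjoint (X j) * X j) $$ (p, l)) * N $$ (l, k))"
      by (simp only: sum_distrib_left sum_distrib_right)
    also have "\<dots> = (\<Sum>l<b. \<Sum>p<b. cnj (N $$ (p, i)) * (1\<^sub>m b $$ (p, l)) * N $$ (l, k))"
      by (intro sum.cong refl) (simp only: id lessThan_iff index_one_mat(1))
    also have "\<dots> = (mat_adjoint N * 1\<^sub>m b * N) $$ (i, k)"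
      using quad_form_index[OF N one_carrier_mat i k] by simp
    finally show "(mat_adjoint N * N) $$ (i, k) = (\<Sum>j\<in>J. (mat_adjoint (X j * N) * (X j * N)) $$ (i, k))"
      by (simp only: right_mult_one_mat[OF Na])
  qed
  then show ?thesis by (simp add: eq eqN cong: sum.cong)
qed

text \<open>The carrier of the running sum is part of the induction claim, because the entry rule
  for a matrix sum depends on its dimensions.\<close>

lemma kraus_family_index:
  assumes Ks: "kraus_family d Ks" and ik: "i < d" "k < d"
  shows "(\<Sum>j<length Ks. (mat_adjoint (Ks ! j) * Ks ! j) $$ (i, k)) = (if i = k then 1 else 0)"
proof -
  have "foldr (+) (map (\<lambda>K. mat_adjoint K * K) Ks) (0\<^sub>m d d) \<in> carrier_mat d d \<and>
    foldr (+) (map (\<lambda>K. mat_adjoint K * K) Ks) (0\<^sub>m d d) $$ (i, k)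
      = (\<Sum>K\<leftarrow>Ks. (mat_adjoint K * K) $$ (i, k))"
    if "\<forall>K \<in> set Ks. dim_col K = d" using that
  proof (induction Ks)
    case (Cons K Ks)
    let ?S = "foldr (+) (map (\<lambda>K. mat_adjoint K * K) Ks) (0\<^sub>m d d)"
    have S: "?S \<in> carrier_mat d d" and K: "dim_col K = d"
      and IH: "?S $$ (i, k) = (\<Sum>K\<leftarrow>Ks. (mat_adjoint K * K) $$ (i, k))"
      using Cons by auto
    have "mat_adjoint K * K \<in> carrier_mat d d" using K by (auto intro: carrier_matI)
    then have "mat_adjoint K * K + ?S \<in> carrier_mat d d"
      "(mat_adjoint K * K + ?S) $$ (i, k) = (mat_adjoint K * K) $$ (i, k) + ?S $$ (i, k)"
      using S ik by auto
    then show ?case using IH by simp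
  qed (use ik in auto)
  then show ?thesis
    using Ks ik by (auto simp: kraus_family_def sum_list_sum_nth atLeast0LessThan)
qed

lemma kraus_family_carrier:
  assumes "kraus_family d (map fst ms)" "(K, P) \<in> set ms"
  shows "K \<in> carrier_mat (dim_row K) d"
proof -
  have "K \<in> set (map fst ms)" using assms(2) by (metis fst_conv image_eqI list.set_map)
  then show ?thesis using assms(1) unfolding kraus_family_def by (metis carrier_matI)
qed

lemma gram_schatten_measure_B:
  assumes s: "power_sign \<alpha> \<sigma>" and Ks: "kraus_family b Ks" and N: "N \<in> carrier_mat b a"
  shows "\<sigma> * (\<Sum>K\<leftarrow>Ks. gram_schatten \<alpha> (K * N)) \<le> \<sigma> * gram_schatten \<alpha> N"
proof -
  have "\<sigma> * (\<Sum>j<length Ks. gram_schatten \<alpha> (Ks ! j * N)) \<le> \<sigma> * gram_schatten \<alpha> N"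
    by (rule gram_schatten_measurement[OF s _ _ kraus_family_index[OF Ks] N, of "\<lambda>j. dim_row (Ks ! j)"])
       (use Ks in \<open>auto simp: kraus_family_def intro!: carrier_matI\<close>)
  then show ?thesis by (simp add: sum_list_sum_nth atLeast0LessThan)
qed

text \<open>Taking adjoints turns multiplication of \<open>N\<close> by
  \<open>transpose_mat K\<close> on the right into multiplication of \<open>mat_adjoint N\<close> by
  the entrywise conjugate of \<open>K\<close> on the left. The conjugates again satisfy
  completeness, since the identity matrix is real.\<close>

lemma gram_schatten_measure_A:
  assumes s: "power_sign \<alpha> \<sigma>" and Ks: "kraus_family a Ks" and N: "N \<in> carrier_mat b a"
  shows "\<sigma> * (\<Sum>K\<leftarrow>Ks. gram_schatten \<alpha> (N * transpose_mat K)) \<le> \<sigma> * gram_schatten \<alpha> N"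
proof -
  define X where "X j = map_mat cnj (Ks ! j)" for j
  have Kc: "Ks ! j \<in> carrier_mat (dim_row (Ks ! j)) a" if "j < length Ks" for j
    using that Ks by (auto simp: kraus_family_def intro!: carrier_matI)
  have XX: "(mat_adjoint (X j) * X j) $$ (i, k) = cnj ((mat_adjoint (Ks ! j) * Ks ! j) $$ (i, k))"
    if "j < length Ks" "i < a" "k < a" for i j k
  proof -
    have "dim_col (Ks ! j) = a" using Kc[OF that(1)] by blast
    then show ?thesis using that(2,3) by (simp del: index_mult_mat(1) add: X_def mult_index_sum)
  qed
  have eq: "gram_schatten \<alpha> (N * transpose_mat (Ks ! j)) = gram_schatten \<alpha> (X j * mat_adjoint N)"
    if "j < length Ks" for j
  proof -
    have "mat_adjoint (transpose_mat (Ks ! j)) = X j"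
      by (auto simp: X_def intro!: eq_matI)
    then have "mat_adjoint (N * transpose_mat (Ks ! j)) = X j * mat_adjoint N"
      using mat_adjoint_mult[OF N transpose_carrier_mat[THEN iffD2, OF Kc[OF that]]] by simp
    then show ?thesis using gram_schatten_adjoint by metis
  qed
  have Xc: "X j \<in> carrier_mat (dim_row (Ks ! j)) a" if "j < length Ks" for j
    using Kc[OF that] unfolding X_def by (rule map_carrier_mat[THEN iffD2])
  have Na: "mat_adjoint N \<in> carrier_mat a b" using N by simp
  have "\<sigma> * (\<Sum>j<length Ks. gram_schatten \<alpha> (X j * mat_adjoint N)) \<le> \<sigma> * gram_schatten \<alpha> (mat_adjoint N)"
  proof (rule gram_schatten_measurement[OF s, of _ _ "\<lambda>j. dim_row (Ks ! j)" a])
    fix i k assume ik: "i < a" "k < a"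
    have "(\<Sum>j<length Ks. (mat_adjoint (X j) * X j) $$ (i, k))
      = cnj (\<Sum>j<length Ks. (mat_adjoint (Ks ! j) * Ks ! j) $$ (i, k))"
      unfolding cnj_sum using ik by (intro sum.cong refl XX) auto
    then show "(\<Sum>j<length Ks. (mat_adjoint (X j) * X j) $$ (i, k)) = (if i = k then 1 else 0)"
      unfolding kraus_family_index[OF Ks ik] by simp
  qed (use Xc Na in auto)
  then show ?thesis by (simp add: sum_list_sum_nth atLeast0LessThan eq gram_schatten_adjoint)
qed

section \<open>Induction over the protocol tree\<close>

lemma outcome_ops_carrier:
  assumes "valid_slocc a b P" "(A, B) \<in> set (outcome_ops a b P)"
  shows "A \<in> carrier_mat (dim_row A) a" "B \<in> carrier_mat (dim_row B) b"
proof -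
  have "dim_col A = a \<and> dim_col B = b"
    using assms
  proof (induction a b P arbitrary: A B rule: outcome_ops.induct)
    case (2 a b ms)
    then obtain K P A' where KP: "(K, P) \<in> set ms" and A: "A = A' * K"
      and o: "(A', B) \<in> set (outcome_ops (dim_row K) b P)" by auto
    have "valid_slocc (dim_row K) b P" using 2(2) KP by auto
    then have "dim_col B = b" using "2.IH"[OF KP refl _ o] by simp
    moreover have "dim_col K = a" using kraus_family_carrier[OF _ KP] 2(2) by auto
    ultimately show ?case unfolding A by simp
  next
    case (3 a b ms)
    then obtain K P B' where KP: "(K, P) \<in> set ms" and B: "B = B' * K"
      and o: "(A, B') \<in> set (outcome_ops a (dim_row K) P)" by auto
    have "valid_slocc a (dim_row K) P" using 3(2) KP by auto
    then have "dim_col A = a" using "3.IH"[OF KP refl _ o] by simp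
    moreover have "dim_col K = b" using kraus_family_carrier[OF _ KP] 3(2) by auto
    ultimately show ?case unfolding B by simp
  qed auto
  then show "A \<in> carrier_mat (dim_row A) a" "B \<in> carrier_mat (dim_row B) b" by (auto intro: carrier_matI)
qed

lemma sum_list_concat_map:
  "(\<Sum>x\<leftarrow>concat (map f xs). g x) = (\<Sum>y\<leftarrow>xs. \<Sum>x\<leftarrow>f y. (g x :: real))"
  by (induction xs) auto

text \<open>The first measurement replaces \<open>N\<close> by \<open>N * transpose_mat K\<close> or
  \<open>K * N\<close>. The induction hypothesis bounds the sum over each subtree by the value at
  its root, and the inequality for a single measurement combines the roots.\<close>

theorem gram_schatten_slocc:
  assumes s: "power_sign \<alpha> \<sigma>" and "valid_slocc a b P" "N \<in> carrier_mat b a"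
  shows "\<sigma> * (\<Sum>(A, B)\<leftarrow>outcome_ops a b P. gram_schatten \<alpha> (B * N * transpose_mat A)) \<le> \<sigma> * gram_schatten \<alpha> N"
  using assms(2,3)
proof (induction a b P arbitrary: N rule: outcome_ops.induct)
  case (1 a b)
  then show ?case by simp
next
  case (2 a b ms)
  have Ks: "kraus_family a (map fst ms)" and val: "\<And>K P. (K, P) \<in> set ms \<Longrightarrow> valid_slocc (dim_row K) b P"
    using 2 by auto
  have N: "N \<in> carrier_mat b a" by fact
  have "(\<Sum>(A, B)\<leftarrow>outcome_ops a b (Measure_A ms). gram_schatten \<alpha> (B * N * transpose_mat A))
    = (\<Sum>(K, P)\<leftarrow>ms. \<Sum>(A, B)\<leftarrow>outcome_ops (dim_row K) b P. gram_schatten \<alpha> (B * N * transpose_mat (A * K)))"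
    by (simp add: sum_list_concat_map case_prod_unfold o_def)
  also have "\<dots> = (\<Sum>(K, P)\<leftarrow>ms. \<Sum>(A, B)\<leftarrow>outcome_ops (dim_row K) b P.
      gram_schatten \<alpha> (B * (N * transpose_mat K) * transpose_mat A))"
  proof -
    \<comment> \<open>Moving the first Kraus operator next to \<open>N\<close> leaves an outcome of
      the subprotocol started from \<open>N * transpose_mat K\<close>.\<close>
    have "B * N * transpose_mat (A * K) = B * (N * transpose_mat K) * transpose_mat A"
      if KP: "(K, P) \<in> set ms" "(A, B) \<in> set (outcome_ops (dim_row K) b P)" for K P A B
    proof -
      have K: "K \<in> carrier_mat (dim_row K) a" using kraus_family_carrier[OF Ks KP(1)] .
      note AB = outcome_ops_carrier[OF val[OF KP(1)] KP(2)]
      have "transpose_mat (A * K) = transpose_mat K * transpose_mat A"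
        using transpose_mult[OF AB(1) K] .
      moreover have T: "transpose_mat K \<in> carrier_mat a (dim_row K)" "transpose_mat A \<in> carrier_mat (dim_row K) (dim_row A)"
        using K AB(1) transpose_carrier_mat by blast+
      ultimately show ?thesis
        using assoc_mult_mat[OF AB(2) N T(1)] assoc_mult_mat[OF mult_carrier_mat[OF AB(2) N] T] by metis
    qed
    then show ?thesis
      by (intro arg_cong[of _ _ sum_list] map_cong refl) (auto intro!: arg_cong[of _ _ sum_list] map_cong)
  qed
  also have "\<sigma> * \<dots> = (\<Sum>(K, P)\<leftarrow>ms. \<sigma> * (\<Sum>(A, B)\<leftarrow>outcome_ops (dim_row K) b P.
      gram_schatten \<alpha> (B * (N * transpose_mat K) * transpose_mat A)))"
    by (simp add: sum_list_const_mult case_prod_unfold)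
  also have "\<dots> \<le> (\<Sum>(K, P)\<leftarrow>ms. \<sigma> * gram_schatten \<alpha> (N * transpose_mat K))"
  proof (rule sum_list_mono, clarify)
    fix K P assume KP: "(K, P) \<in> set ms"
    then have "K \<in> carrier_mat (dim_row K) a" using kraus_family_carrier[OF Ks] by blast
    then have "N * transpose_mat K \<in> carrier_mat b (dim_row K)"
      using N transpose_carrier_mat mult_carrier_mat by blast
    then show "\<sigma> * (\<Sum>(A, B)\<leftarrow>outcome_ops (dim_row K) b P.
      gram_schatten \<alpha> (B * (N * transpose_mat K) * transpose_mat A)) \<le> \<sigma> * gram_schatten \<alpha> (N * transpose_mat K)"
      using "2.IH"[OF KP refl val[OF KP]] by simp
  qed
  also have "\<dots> = \<sigma> * (\<Sum>K\<leftarrow>map fst ms. gram_schatten \<alpha> (N * transpose_mat K))"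
    by (simp add: sum_list_const_mult case_prod_unfold o_def)
  also have "\<dots> \<le> \<sigma> * gram_schatten \<alpha> N" by (rule gram_schatten_measure_A[OF s Ks N])
  finally show ?case .
next
  case (3 a b ms)
  have Ks: "kraus_family b (map fst ms)" and val: "\<And>K P. (K, P) \<in> set ms \<Longrightarrow> valid_slocc a (dim_row K) P"
    using 3 by auto
  have N: "N \<in> carrier_mat b a" by fact
  have "(\<Sum>(A, B)\<leftarrow>outcome_ops a b (Measure_B ms). gram_schatten \<alpha> (B * N * transpose_mat A))
    = (\<Sum>(K, P)\<leftarrow>ms. \<Sum>(A, B)\<leftarrow>outcome_ops a (dim_row K) P. gram_schatten \<alpha> (B * K * N * transpose_mat A))"
    by (simp add: sum_list_concat_map case_prod_unfold o_def)
  also have "\<dots> = (\<Sum>(K, P)\<leftarrow>ms. \<Sum>(A, B)\<leftarrow>outcome_ops a (dim_row K) P.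
      gram_schatten \<alpha> (B * (K * N) * transpose_mat A))"
  proof -
    have "B * K * N = B * (K * N)"
      if KP: "(K, P) \<in> set ms" "(A, B) \<in> set (outcome_ops a (dim_row K) P)" for K P A B
    proof -
      have K: "K \<in> carrier_mat (dim_row K) b" using kraus_family_carrier[OF Ks KP(1)] .
      show ?thesis using assoc_mult_mat[OF outcome_ops_carrier(2)[OF val[OF KP(1)] KP(2)] K N] .
    qed
    then show ?thesis
      by (intro arg_cong[of _ _ sum_list] map_cong refl) (auto intro!: arg_cong[of _ _ sum_list] map_cong)
  qed
  also have "\<sigma> * \<dots> = (\<Sum>(K, P)\<leftarrow>ms. \<sigma> * (\<Sum>(A, B)\<leftarrow>outcome_ops a (dim_row K) P.
      gram_schatten \<alpha> (B * (K * N) * transpose_mat A)))"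
    by (simp add: sum_list_const_mult case_prod_unfold)
  also have "\<dots> \<le> (\<Sum>(K, P)\<leftarrow>ms. \<sigma> * gram_schatten \<alpha> (K * N))"
  proof (rule sum_list_mono, clarify)
    fix K P assume KP: "(K, P) \<in> set ms"
    then have "K \<in> carrier_mat (dim_row K) b" using kraus_family_carrier[OF Ks] by blast
    then have "K * N \<in> carrier_mat (dim_row K) a" using N by (rule mult_carrier_mat)
    then show "\<sigma> * (\<Sum>(A, B)\<leftarrow>outcome_ops a (dim_row K) P.
      gram_schatten \<alpha> (B * (K * N) * transpose_mat A)) \<le> \<sigma> * gram_schatten \<alpha> (K * N)"
      using "3.IH"[OF KP refl val[OF KP]] by simp
  qed
  also have "\<dots> = \<sigma> * (\<Sum>K\<leftarrow>map fst ms. gram_schatten \<alpha> (K * N))"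
    by (simp add: sum_list_const_mult case_prod_unfold o_def)
  also have "\<dots> \<le> \<sigma> * gram_schatten \<alpha> N" by (rule gram_schatten_measure_B[OF s Ks N])
  finally show ?case .
qed

subsection \<open>States and outcomes\<close>

definition amplitude_mat :: "nat \<Rightarrow> nat \<Rightarrow> complex vec \<Rightarrow> complex mat" where
  "amplitude_mat a b \<Psi> = mat b a (\<lambda>(j, i). \<Psi> $ (i * b + j))"

lemma amplitude_mat_carrier [simp]: "amplitude_mat a b \<Psi> \<in> carrier_mat b a"
  by (simp add: amplitude_mat_def)

lemma pair_index_less:
  fixes a b i j :: nat
  assumes "i < a" "j < b" shows "i * b + j < a * b"
proof -
  have "i * b + j < Suc i * b" using assms by simp
  also have "\<dots> \<le> a * b" using assms by (intro mult_right_mono) auto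
  finally show ?thesis .
qed

lemma sum_pair_index: "(\<Sum>r<a * b. f r) = (\<Sum>i<a. \<Sum>j<(b::nat). (f (i * b + j) :: 'a :: comm_monoid_add))"
proof (induction a)
  case (Suc a)
  have "{..<a * b + b} = {..<a * b} \<union> {a * b..<a * b + b}" by auto
  then have "(\<Sum>r<a * b + b. f r) = (\<Sum>r<a * b. f r) + (\<Sum>r=a * b..<a * b + b. f r)"
    by (simp add: sum.union_disjoint ivl_disj_int)
  also have "(\<Sum>r=a * b..<a * b + b. f r) = (\<Sum>j<b. f (a * b + j))"
    using sum.shift_bounds_nat_ivl[of f 0 "a * b" b] by (simp add: atLeast0LessThan add.commute)
  finally show ?case using Suc by (simp add: add.commute)
qed simp

lemma reduced_B_amplitude:
  assumes "\<Psi> \<in> carrier_vec (a * b)"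
  shows "reduced_B a b \<Psi> = amplitude_mat a b \<Psi> * mat_adjoint (amplitude_mat a b \<Psi>)"
  using assms
  by (auto simp del: index_mult_mat(1) intro!: eq_matI
      simp: reduced_B_def ptrace_A_def ketbra_def mult_index_sum amplitude_mat_def pair_index_less)

text \<open>The vectorisation identity for Kronecker products, in the index convention
  \<open>i * b + j\<close>.\<close>

lemma kron_amplitude:
  assumes A: "A \<in> carrier_mat a' a" and B: "B \<in> carrier_mat b' b" and \<Psi>: "\<Psi> \<in> carrier_vec (a * b)"
  shows "amplitude_mat a' b' (kron A B *\<^sub>v \<Psi>) = B * amplitude_mat a b \<Psi> * transpose_mat A"
proof (rule eq_matI)
  fix j i assume "j < dim_row (B * amplitude_mat a b \<Psi> * transpose_mat A)"
    "i < dim_col (B * amplitude_mat a b \<Psi> * transpose_mat A)"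
  then have j: "j < b'" and i: "i < a'" using A B by auto
  have "amplitude_mat a' b' (kron A B *\<^sub>v \<Psi>) $$ (j, i) = (kron A B *\<^sub>v \<Psi>) $ (i * b' + j)"
    using i j by (simp add: amplitude_mat_def)
  also have "\<dots> = (\<Sum>r<a * b. kron A B $$ (i * b' + j, r) * \<Psi> $ r)"
    using A B \<Psi> pair_index_less[OF i j]
    by (simp add: kron_def scalar_prod_def atLeast0LessThan)
  also have "\<dots> = (\<Sum>k<a. \<Sum>l<b. kron A B $$ (i * b' + j, k * b + l) * \<Psi> $ (k * b + l))"
    by (rule sum_pair_index)
  also have "\<dots> = (\<Sum>k<a. \<Sum>l<b. B $$ (j, l) * amplitude_mat a b \<Psi> $$ (l, k) * A $$ (i, k))"
    using A B i j pair_index_less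
    by (intro sum.cong refl) (auto simp: kron_def amplitude_mat_def)
  also have "\<dots> = (B * amplitude_mat a b \<Psi> * transpose_mat A) $$ (j, i)"
    using A B i j carrier_matD[OF amplitude_mat_carrier[of a b \<Psi>]] 
    by (simp del: index_mult_mat(1) add: mult_index_sum sum_distrib_right)
  finally show "amplitude_mat a' b' (kron A B *\<^sub>v \<Psi>) $$ (j, i) = (B * amplitude_mat a b \<Psi> * transpose_mat A) $$ (j, i)" .
qed (use A B in \<open>auto simp: amplitude_mat_def\<close>)

lemma amplitude_mat_smult:
  assumes "\<Psi> \<in> carrier_vec (a * b)"
  shows "amplitude_mat a b (c \<cdot>\<^sub>v \<Psi>) = c \<cdot>\<^sub>m amplitude_mat a b \<Psi>"
  using assms by (auto simp: amplitude_mat_def pair_index_less intro!: eq_matI)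

text \<open>Both sides are the trace of \<open>?N * mat_adjoint ?N\<close>, the sum of the squared
  moduli of all amplitudes. Probabilities thereby become the case \<alpha> = 1 of the general
  inequality.\<close>

lemma vec_norm_amplitude:
  assumes "\<Psi> \<in> carrier_vec (a * b)"
  shows "(vec_norm \<Psi>)\<^sup>2 = gram_schatten 1 (amplitude_mat a b \<Psi>)"
proof -
  let ?N = "amplitude_mat a b \<Psi>"
  have psd: "psd_mat b (?N * mat_adjoint ?N)" by (rule psd_mat_gram[OF amplitude_mat_carrier])
  have "mat_trace (?N * mat_adjoint ?N) = (\<Sum>j<b. \<Sum>i<a. \<Psi> $ (i * b + j) * cnj (\<Psi> $ (i * b + j)))"
    by (simp del: index_mult_mat(1) add: mat_trace_def mult_index_sum amplitude_mat_def)
  also have "\<dots> = (\<Sum>i<a. \<Sum>j<b. \<Psi> $ (i * b + j) * cnj (\<Psi> $ (i * b + j)))" by (rule sum.swap)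
  also have "\<dots> = \<Psi> \<bullet>c \<Psi>"
    using assms sum_pair_index[of "\<lambda>r. \<Psi> $ r * cnj (\<Psi> $ r)" a b]
    by (simp add: scalar_prod_def atLeast0LessThan)
  finally have "Re (\<Psi> \<bullet>c \<Psi>) = power_trace 1 (?N * mat_adjoint ?N)"
    by (simp add: power_trace_1[OF psd])
  then show ?thesis
    using power_trace_nonneg[OF psd, of 1] by (simp add: vec_norm_def gram_schatten_def schatten_def)
qed

lemma renyi_power_trace:
  assumes "\<alpha> \<noteq> 1"
  shows "(1 - \<alpha>) * renyi_ee \<alpha> a b \<Psi> = ln (power_trace \<alpha> (reduced_B a b \<Psi>))"
  using assms by (simp add: renyi_ee_def power_trace_def)

text \<open>If \<open>p > 0\<close>, the Gram matrix of the unnormalised outcome is \<open>p\<close>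
  times the reduced outcome state, and homogeneity of degree 1 extracts the factor
  \<open>p\<close>.\<close>

lemma outcome_schatten:
  fixes \<Psi> :: "complex vec" and A B :: "complex mat" and a b a' b' :: nat and \<alpha> :: real
  defines "N \<equiv> amplitude_mat a b \<Psi>"
  assumes A: "A \<in> carrier_mat a' a" and B: "B \<in> carrier_mat b' b" and \<Psi>: "\<Psi> \<in> carrier_vec (a * b)"
    and \<alpha>: "0 < \<alpha>"
  defines "p \<equiv> outcome_prob \<Psi> (A, B)" and "x \<equiv> power_trace \<alpha> (reduced_B a' b' (outcome_state \<Psi> (A, B)))"
  shows "p = gram_schatten 1 (B * N * transpose_mat A)"
    and "gram_schatten \<alpha> (B * N * transpose_mat A) = p * x powr (1 / \<alpha>)"
    and "0 < p \<Longrightarrow> 0 < x"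
proof -
  let ?v = "kron A B *\<^sub>v \<Psi>" and ?M = "B * N * transpose_mat A"
  have v: "?v \<in> carrier_vec (a' * b')" using carrier_matD[OF A] carrier_matD[OF B] by (intro carrier_vecI) (simp add: kron_def)
  have M: "amplitude_mat a' b' ?v = ?M" unfolding N_def by (rule kron_amplitude[OF A B \<Psi>])
  have Mc: "?M \<in> carrier_mat b' a'" unfolding M[symmetric] by simp
  have psd: "psd_mat b' (?M * mat_adjoint ?M)" by (rule psd_mat_gram[OF Mc])
  show p: "p = gram_schatten 1 ?M"
    using vec_norm_amplitude[OF v] unfolding p_def outcome_prob_def by (simp add: M)
  then have p1: "p = power_trace 1 (?M * mat_adjoint ?M)"
    using power_trace_nonneg[OF psd, of 1] by (simp add: gram_schatten_def schatten_def)
  then have p0: "0 \<le> p" using power_trace_nonneg[OF psd, of 1] by simp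
  have "amplitude_mat a' b' (outcome_state \<Psi> (A, B)) = complex_of_real (1 / sqrt p) \<cdot>\<^sub>m ?M"
    using amplitude_mat_smult[OF v] unfolding M[symmetric] outcome_state_def p_def by simp
  moreover have "outcome_state \<Psi> (A, B) \<in> carrier_vec (a' * b')"
    using v by (simp add: outcome_state_def)
  ultimately have "reduced_B a' b' (outcome_state \<Psi> (A, B))
      = (complex_of_real (1 / sqrt p) \<cdot>\<^sub>m ?M) * mat_adjoint (complex_of_real (1 / sqrt p) \<cdot>\<^sub>m ?M)"
    by (simp add: reduced_B_amplitude)
  also have "mat_adjoint (complex_of_real (1 / sqrt p) \<cdot>\<^sub>m ?M) = complex_of_real (1 / sqrt p) \<cdot>\<^sub>m mat_adjoint ?M"
    using carrier_matD[OF Mc] by (intro eq_matI) (auto simp del: index_mult_mat(1))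
  also have "(complex_of_real (1 / sqrt p) \<cdot>\<^sub>m ?M) * (complex_of_real (1 / sqrt p) \<cdot>\<^sub>m mat_adjoint ?M)
      = complex_of_real (1 / p) \<cdot>\<^sub>m (?M * mat_adjoint ?M)"
  proof -
    have "1 / sqrt p * (1 / sqrt p) = 1 / p" using p0 by (simp add: real_sqrt_mult_self flip: of_real_mult)
    then have "complex_of_real (1 / sqrt p) * complex_of_real (1 / sqrt p) = complex_of_real (1 / p)"
      by (simp only: of_real_mult[symmetric])
    moreover have "c \<cdot>\<^sub>m (d \<cdot>\<^sub>m X) = (c * d) \<cdot>\<^sub>m X" for c d :: complex and X
      by (rule eq_matI) (auto simp del: index_mult_mat(1))
    ultimately show ?thesis
      unfolding mult_smult_assoc_mat[OF Mc smult_carrier_mat[OF mat_adjoint_carrier[OF Mc]]]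
        mult_smult_distrib[OF Mc mat_adjoint_carrier[OF Mc]] 
      by (simp only:)
  qed
  finally have x: "x = (1 / p) powr \<alpha> * power_trace \<alpha> (?M * mat_adjoint ?M)"
    unfolding x_def using p0 by (simp only: power_trace_smult[OF psd] divide_nonneg_nonneg zero_le_one)
  note t0 = power_trace_nonneg[OF psd, of \<alpha>] and tz = power_trace_zero_iff[OF psd, of \<alpha> 1, folded p1]
  \<comment> \<open>For \<open>p = 0\<close> the Gram matrix has zero spectrum, so both sides are 0
    despite the default value \<open>1 / p = 0\<close>.\<close>
  show "gram_schatten \<alpha> ?M = p * x powr (1 / \<alpha>)"
    using p0 t0 tz \<alpha> by (cases "p = 0") (auto simp: x gram_schatten_def schatten_def powr_mult powr_powr)
  show "0 < p \<Longrightarrow> 0 < x" using t0 tz by (auto simp: x less_le)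
qed

section \<open>Averages over the outcome ensemble\<close>

lemma sum_outcome_filter:
  "(\<Sum>m\<leftarrow>filter (\<lambda>m. outcome_prob \<Psi> m > 0) ops. outcome_prob \<Psi> m * f m) = (\<Sum>m\<leftarrow>ops. outcome_prob \<Psi> m * f m)"
proof (induction ops)
  case (Cons m ops)
  have "0 \<le> outcome_prob \<Psi> m" by (simp add: outcome_prob_def)
  with Cons show ?case by auto
qed simp

text \<open>The tree inequality at exponent 1 holds with both signs, hence with equality.\<close>

lemma outcome_prob_total:
  assumes \<Psi>: "\<Psi> \<in> carrier_vec (a * b)" and norm: "vec_norm \<Psi> = 1" and val: "valid_slocc a b P"
  shows "(\<Sum>m\<leftarrow>outcome_ops a b P. outcome_prob \<Psi> m) = 1"
proof -
  let ?N = "amplitude_mat a b \<Psi>"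
  have "outcome_prob \<Psi> (A, B) = gram_schatten 1 (B * ?N * transpose_mat A)"
    if "(A, B) \<in> set (outcome_ops a b P)" for A B
    using outcome_schatten(1)[OF outcome_ops_carrier[OF val that] \<Psi>, of 1] by simp
  then have "(\<Sum>m\<leftarrow>outcome_ops a b P. outcome_prob \<Psi> m)
    = (\<Sum>(A, B)\<leftarrow>outcome_ops a b P. gram_schatten 1 (B * ?N * transpose_mat A))"
    by (intro arg_cong[of _ _ sum_list] map_cong refl) auto
  moreover have "gram_schatten 1 ?N = 1" using vec_norm_amplitude[OF \<Psi>] norm by simp
  ultimately show ?thesis
    using gram_schatten_slocc[OF _ val amplitude_mat_carrier, of 1 1 \<Psi>]
      gram_schatten_slocc[OF _ val amplitude_mat_carrier, of 1 "-1" \<Psi>]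
    by (simp add: power_sign_def)
qed

text \<open>The tree inequality at exponent \<alpha> compares the mean of
  \<open>x m powr (1 / \<alpha>)\<close> with \<open>x0 powr (1 / \<alpha>)\<close>. Jensen with
  exponent \<open>s * \<alpha>\<close> turns this into a comparison of the mean of
  \<open>x m powr s\<close> with \<open>x0 powr s\<close>. The two steps chain because both
  exponents have the same sign \<open>\<sigma>\<close>.\<close>

lemma ree_exp_average_bound:
  assumes \<Psi>: "\<Psi> \<in> carrier_vec (a * b)" and norm: "vec_norm \<Psi> = 1" and val: "valid_slocc a b P"
    and \<alpha>: "power_sign \<alpha> \<sigma>" "\<alpha> \<noteq> 1" and s: "power_sign (s * \<alpha>) \<sigma>"
  shows "\<sigma> * ree_exp_average \<alpha> s a b P \<Psi> \<le> \<sigma>"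
proof -
  define N where "N = amplitude_mat a b \<Psi>"
  have N: "N \<in> carrier_mat b a" by (simp add: N_def)
  note \<alpha>0 = power_signD(1)[OF \<alpha>(1)] and sg = power_signD(2)[OF \<alpha>(1)] and s\<alpha>0 = power_signD(1)[OF s]
  define x0 where "x0 = power_trace \<alpha> (reduced_B a b \<Psi>)"
  define p where "p = outcome_prob \<Psi>"
  define x where "x m = power_trace \<alpha> (reduced_B (dim_row (fst m)) (dim_row (snd m)) (outcome_state \<Psi> m))" for m
  define ops where "ops = outcome_ops a b P"
  define ms where "ms = filter (\<lambda>m. p m > 0) ops"
  have ops: "p m = gram_schatten 1 (snd m * N * transpose_mat (fst m))"
      "gram_schatten \<alpha> (snd m * N * transpose_mat (fst m)) = p m * x m powr (1 / \<alpha>)"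
      "0 < p m \<Longrightarrow> 0 < x m" if "m \<in> set ops" for m
    using outcome_schatten[OF outcome_ops_carrier[OF val, of "fst m" "snd m"] \<Psi> \<alpha>0] that
    by (simp_all add: N_def p_def x_def ops_def)
  have psd: "psd_mat b (N * mat_adjoint N)" by (rule psd_mat_gram[OF N])
  have x0: "x0 = power_trace \<alpha> (N * mat_adjoint N)" unfolding x0_def N_def reduced_B_amplitude[OF \<Psi>] ..
  have N1: "gram_schatten 1 N = 1" using vec_norm_amplitude[OF \<Psi>] norm by (simp add: N_def)
  then have "power_trace 1 (N * mat_adjoint N) \<noteq> 0" by (auto simp: gram_schatten_def schatten_def)
  \<comment> \<open>The initial reduced state has trace 1, so its spectrum is not zero.\<close>
  then have x0pos: "0 < x0"
    using power_trace_nonneg[OF psd, of \<alpha>] power_trace_zero_iff[OF psd, of \<alpha> 1] by (simp add: x0)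
  have Na: "gram_schatten \<alpha> N = x0 powr (1 / \<alpha>)" by (simp add: x0 gram_schatten_def schatten_def)
  have pnn: "0 \<le> p m" for m by (simp add: p_def outcome_prob_def)
  note filt = sum_outcome_filter[where ops = ops and \<Psi> = \<Psi>, folded p_def, folded ms_def]
  have total: "(\<Sum>m\<leftarrow>ms. p m) = 1"
    using filt[of "\<lambda>_. 1"] outcome_prob_total[OF \<Psi> norm val] by (simp add: p_def ops_def ms_def)
  have mean: "\<sigma> * (\<Sum>m\<leftarrow>ms. p m * x m powr (1 / \<alpha>)) \<le> \<sigma> * x0 powr (1 / \<alpha>)"
  proof -
    have "(\<Sum>m\<leftarrow>ms. p m * x m powr (1 / \<alpha>)) = (\<Sum>m\<leftarrow>ops. gram_schatten \<alpha> (snd m * N * transpose_mat (fst m)))"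
      unfolding filt by (intro arg_cong[of _ _ sum_list] map_cong refl ops(2)[symmetric])
    then show ?thesis
      using gram_schatten_slocc[OF \<alpha>(1) val N] by (simp add: Na ops_def case_prod_unfold)
  qed
  have xpos: "0 < x m" if "m \<in> set ms" for m using ops(3)[of m] that by (auto simp: ms_def)
  have "\<sigma> * (\<Sum>m\<leftarrow>ms. p m * (x m powr (1 / \<alpha>)) powr (s * \<alpha>)) 
      \<le> \<sigma> * (\<Sum>m\<leftarrow>ms. p m * x m powr (1 / \<alpha>)) powr (s * \<alpha>)"
    using Jensen_powr[OF s, of "{..<length ms}" "\<lambda>i. p (ms ! i)" "\<lambda>i. x (ms ! i) powr (1 / \<alpha>)"] total pnn
    by (simp add: sum_list_sum_nth atLeast0LessThan)
  also have "\<dots> \<le> \<sigma> * (x0 powr (1 / \<alpha>)) powr (s * \<alpha>)"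
    using sg s\<alpha>0 pnn by (intro sign_powr_mono mean) (auto intro!: sum_list_nonneg)
  finally have main: "\<sigma> * (\<Sum>m\<leftarrow>ms. p m * x m powr s) \<le> \<sigma> * x0 powr s"
    using \<alpha>0 by (simp add: powr_powr)
  \<comment> \<open>The factor \<open>1 - \<alpha>\<close> cancels the prefactor of the entropy,
    leaving a difference of logarithms.\<close>
  have ratio: "exp (s * (1 - \<alpha>) * (renyi_ee \<alpha> (dim_row (fst m)) (dim_row (snd m)) (outcome_state \<Psi> m) - renyi_ee \<alpha> a b \<Psi>))
      = x m powr s / x0 powr s" if "m \<in> set ms" for m
  proof -
    have "s * (1 - \<alpha>) * (renyi_ee \<alpha> (dim_row (fst m)) (dim_row (snd m)) (outcome_state \<Psi> m) - renyi_ee \<alpha> a b \<Psi>)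
      = s * ln (x m) - s * ln x0"
      unfolding x_def x0_def renyi_power_trace[OF \<alpha>(2), symmetric] by (simp add: algebra_simps)
    then show ?thesis using xpos[OF that] x0pos by (simp add: powr_def exp_diff)
  qed
  have "ree_exp_average \<alpha> s a b P \<Psi> = (\<Sum>m\<leftarrow>ms. p m * (x m powr s / x0 powr s))"
    unfolding ree_exp_average_def ensemble_def
    by (simp add: o_def p_def[symmetric] ops_def[symmetric] ms_def[symmetric] ratio cong: map_cong)
  also have "\<dots> = (\<Sum>m\<leftarrow>ms. p m * x m powr s) / x0 powr s"
    using sum_list_mult_const[of "\<lambda>m. p m * x m powr s" "inverse (x0 powr s)" ms]
    by (simp add: divide_inverse mult.assoc)
  finally have "\<sigma> * ree_exp_average \<alpha> s a b P \<Psi> = (\<sigma> * (\<Sum>m\<leftarrow>ms. p m * x m powr s)) / x0 powr s" by simp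
  also have "\<dots> \<le> (\<sigma> * x0 powr s) / x0 powr s" using main by (rule divide_right_mono) simp
  finally show ?thesis using x0pos by simp
qed

text \<open>Here every exponential is 1 and the average is the total probability. This case is
  separate because \<open>power_sign (s * \<alpha>)\<close> demands a positive exponent.\<close>

lemma ree_exp_average_0:
  assumes "\<Psi> \<in> carrier_vec (a * b)" "vec_norm \<Psi> = 1" "valid_slocc a b P"
  shows "ree_exp_average \<alpha> 0 a b P \<Psi> = 1"
proof -
  have "ree_exp_average \<alpha> 0 a b P \<Psi>
      = (\<Sum>m\<leftarrow>filter (\<lambda>m. outcome_prob \<Psi> m > 0) (outcome_ops a b P). outcome_prob \<Psi> m * 1)"
    by (simp add: ree_exp_average_def ensemble_def o_def)
  then show ?thesis
    unfolding sum_outcome_filter using outcome_prob_total[OF assms] by simp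
qed

text \<open>The conditions on \<open>s\<close> put \<open>s * \<alpha>\<close> on the same side of 1
  as \<alpha>, so both powers are concave, or both convex. For negative \<open>s\<close> the first
  bound can fail: measuring one half of an entangled pair in its Schmidt basis destroys the
  entanglement with certainty, and the average then exceeds 1.\<close>

theorem theorem1:
  fixes \<Psi> :: "complex vec" and a b :: nat and P :: slocc and \<alpha> s :: real
  assumes "\<Psi> \<in> carrier_vec (a * b)"
    and "vec_norm \<Psi> = 1"
    and "valid_slocc a b P"
  shows "(0 < \<alpha> \<and> \<alpha> < 1 \<and> 0 \<le> s \<and> s \<le> 1 / \<alpha> \<longrightarrow> ree_exp_average \<alpha> s a b P \<Psi> \<le> 1) \<and>
         (1 < \<alpha> \<and> 1 / \<alpha> \<le> s \<longrightarrow> ree_exp_average \<alpha> s a b P \<Psi> \<ge> 1)"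
proof (intro conjI impI; elim conjE)
  assume \<alpha>: "0 < \<alpha>" "\<alpha> < 1" and s: "0 \<le> s" "s \<le> 1 / \<alpha>"
  show "ree_exp_average \<alpha> s a b P \<Psi> \<le> 1"
  proof (cases "s = 0")
    case False
    have "power_sign \<alpha> 1" "power_sign (s * \<alpha>) 1"
      using \<alpha> s False by (auto simp: power_sign_def pos_le_divide_eq)
    then show ?thesis using ree_exp_average_bound[OF assms, of \<alpha> 1 s] \<alpha> by simp
  qed (simp add: ree_exp_average_0[OF assms])
next
  assume \<alpha>: "1 < \<alpha>" and s: "1 / \<alpha> \<le> s"
  have "0 < s" using \<alpha> s by (smt (verit) divide_pos_pos)
  then have "power_sign \<alpha> (-1)" "power_sign (s * \<alpha>) (-1)"
    using \<alpha> s by (auto simp: power_sign_def pos_divide_le_eq)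
  then show "ree_exp_average \<alpha> s a b P \<Psi> \<ge> 1"
    using ree_exp_average_bound[OF assms, of \<alpha> "-1" s] \<alpha> by simp
qed

end
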